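(* Let $U_1,\dots,U_r$ be $\mathfrak{g}$-modules and let $z_1,\dots,z_r$ be nonzero complex numbers. For any restricted $\hat{\mathfrak{g}}[\sigma]$-module $W$, we have $$(x-z_1)\cdots(x-z_r)a(x)\in\mathrm{Hom}(M,M((x^{1/N})))\quad\text{for all }a\in\mathfrak{g},$$ where $M$ denotes the tensor product $\hat{\mathfrak{g}}[\sigma]$-module $W\otimes U_1(z_1)\otimes\cdots\otimes U_r(z_r)$.
   Context: Let $\mathfrak{g}$ be a finite-dimensional simple Lie algebra over $\mathbb{C}$ with the nondegenerate symmetric invariant bilinear form $\langle\cdot,\cdot\rangle$ normalized so that the squared length of the longest roots is $2$. Let $\sigma$ be an automorphism of $\mathfrak{g}$ of order $N$, $\varepsilon=\exp(2\pi \sqrt{-1}/N)$, and $\mathfrak{g}_i=\{a\in\mathfrak{g}\mid \sigma(a)=\varepsilon^i a\}$ for $0\le i\le N-1$, so $\mathfrak{g}=\bigoplus_{i=0}^{N-1}\mathfrak{g}_i$. The twisted affine Lie algebra is $\hat{\mathfrak{g}}[\sigma]=\bigoplus_{i=0}^{N-1}\mathfrak{g}_i\otimes t^{i/N}\mathbb{C}[t,t^{-1}]\oplus\mathbb{C}\mathbf{k}$ with $\mathbf{k}$ a nonzero central element and $[a\otimes t^{m+i/N},b\otimes t^{n+j/N}]=[a,b]\otimes t^{m+n+(i+j)/N}+(m+\tfrac{i}{N})\langle a,b\rangle\delta_{m+i/N,\,-n-j/N}\mathbf{k}$ for $a\in\mathfrak{g}_i$, $b\in\mathfrak{g}_j$,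 $m,n\in\mathbb{Z}$. For $a\in\mathfrak{g}_i$ put $a(x)=\sum_{n\in\mathbb{Z}}(a\otimes t^{n+i/N})x^{-n-i/N-1}$, extended linearly to all $a\in\mathfrak{g}$; on a module $M$ it is regarded as an element of $(\mathrm{End}\,M)[[x^{1/N},x^{-1/N}]]$ (doubly infinite formal series). For a vector space $M$, $M((x^{1/N}))$ is the space of lower truncated formal Laurent series in $x^{1/N}$ with coefficients in $M$, and $\mathrm{Hom}(M,M((x^{1/N})))$ is identified with the set of series $A(x)\in(\mathrm{End}\,M)[[x^{1/N},x^{-1/N}]]$ with $A(x)w\in M((x^{1/N}))$ for all $w\in M$. A $\hat{\mathfrak{g}}[\sigma]$-module $W$ is restricted if $a(x)\in\mathrm{Hom}(W,W((x^{1/N})))$ for all $a\in\mathfrak{g}$. Evaluation modules: for each nonzero complex number $z$ fix an $N$-th root $z^{1/N}$. For a $\mathfrak{g}$-module $U$, $U(z)$ is the space $U$ with the $\hat{\mathfrak{g}}[\sigma]$-action $(a\otimes t^{n+i/N})u=z^{n+i/N}(au)$ for $a\in\mathfrak{g}_i$, $n\in\mathbb{Z}$, $u\in U$ (where $z^{n+i/N}=z^n(z^{1/N})^i$), and $\mathbf{k}U=0$. *)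

theory Defs
  imports
    Complex_Main
    "HOL-Computational_Algebra.Polynomial"
    "HOL-Library.FuncSet"
    "HOL-Algebra.AbelCoset"
    "HOL-Algebra.Module"
begin

section \<open>Complex vector spaces\<close>

text \<open>Vector spaces over the complex numbers are modules, in the sense of HOL-Algebra, over the
  field of complex numbers. The multiplicative fields of the record are never used.\<close>

definition complex_field :: "complex ring" where
  "complex_field = \<lparr>carrier = UNIV, mult = (*), one = 1, zero = 0, add = (+)\<rparr>"

definition lin_span :: "(complex, 'v) module \<Rightarrow> 'v set \<Rightarrow> 'v set" where
  "lin_span V X = \<Inter> {S. submodule S complex_field V \<and> X \<subseteq> S}"

definition finite_dimensional :: "(complex, 'v) module \<Rightarrow> bool" where
  "finite_dimensional V \<longleftrightarrow>
     (\<exists>B. finite B \<and> B \<subseteq> carrier V \<and> lin_span V B = carrier V)"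

definition linear_map :: "(complex, 'v) module \<Rightarrow> (complex, 'w) module \<Rightarrow> ('v \<Rightarrow> 'w) \<Rightarrow> bool" where
  "linear_map V W f \<longleftrightarrow>
     f \<in> carrier V \<rightarrow> carrier W \<and>
     (\<forall>x\<in>carrier V. \<forall>y\<in>carrier V. f (x \<oplus>\<^bsub>V\<^esub> y) = f x \<oplus>\<^bsub>W\<^esub> f y) \<and>
     (\<forall>c. \<forall>x\<in>carrier V. f (c \<odot>\<^bsub>V\<^esub> x) = c \<odot>\<^bsub>W\<^esub> f x)"

definition quotient_space :: "(complex, 'v) module \<Rightarrow> 'v set \<Rightarrow> (complex, 'v set) module" where
  "quotient_space V S =
     \<lparr>carrier = a_rcosets\<^bsub>V\<^esub> S, mult = undefined, one = undefined,
      zero = S, add = set_add V,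
      smult = (\<lambda>c A. \<Union>a\<in>A. S +>\<^bsub>V\<^esub> (c \<odot>\<^bsub>V\<^esub> a))\<rparr>"

definition free_space :: "'b set \<Rightarrow> (complex, 'b \<Rightarrow> complex) module" where
  "free_space B =
     \<lparr>carrier = {f. finite {b. f b \<noteq> 0} \<and> {b. f b \<noteq> 0} \<subseteq> B}, mult = undefined, one = undefined,
      zero = (\<lambda>b. 0), add = (\<lambda>f g b. f b + g b),
      smult = (\<lambda>c f b. c * f b)\<rparr>"

definition free_gen :: "'b \<Rightarrow> 'b \<Rightarrow> complex" where
  "free_gen b = (\<lambda>b'. if b' = b then 1 else 0)"


section \<open>Lie algebras and their modules\<close>

locale lie_algebra = Module.module complex_field L
  for L :: "(complex, 'a) module" (structure) +
  fixes br :: "'a \<Rightarrow> 'a \<Rightarrow> 'a"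
  assumes br_closed: "\<lbrakk>x \<in> carrier L; y \<in> carrier L\<rbrakk> \<Longrightarrow> br x y \<in> carrier L"
    and br_add_left: "\<lbrakk>x \<in> carrier L; y \<in> carrier L; w \<in> carrier L\<rbrakk>
      \<Longrightarrow> br (x \<oplus> y) w = br x w \<oplus> br y w"
    and br_add_right: "\<lbrakk>x \<in> carrier L; y \<in> carrier L; w \<in> carrier L\<rbrakk>
      \<Longrightarrow> br w (x \<oplus> y) = br w x \<oplus> br w y"
    and br_smult_left: "\<lbrakk>x \<in> carrier L; y \<in> carrier L\<rbrakk> \<Longrightarrow> br (c \<odot> x) y = c \<odot> br x y"
    and br_smult_right: "\<lbrakk>x \<in> carrier L; y \<in> carrier L\<rbrakk> \<Longrightarrow> br x (c \<odot> y) = c \<odot> br x y"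
    and br_alternating: "x \<in> carrier L \<Longrightarrow> br x x = \<zero>\<^bsub>L\<^esub>"
    and jacobi: "\<lbrakk>x \<in> carrier L; y \<in> carrier L; w \<in> carrier L\<rbrakk>
      \<Longrightarrow> br x (br y w) \<oplus> br y (br w x) \<oplus> br w (br x y) = \<zero>\<^bsub>L\<^esub>"

definition lie_ideal :: "(complex, 'a) module \<Rightarrow> ('a \<Rightarrow> 'a \<Rightarrow> 'a) \<Rightarrow> 'a set \<Rightarrow> bool" where
  "lie_ideal L br J \<longleftrightarrow>
     submodule J complex_field L \<and> (\<forall>x\<in>carrier L. \<forall>y\<in>J. br x y \<in> J)"

locale simple_lie_algebra = lie_algebra +
  assumes nonabelian: "\<exists>x\<in>carrier L. \<exists>y\<in>carrier L. br x y \<noteq> \<zero>\<^bsub>L\<^esub>"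
    and no_proper_ideals: "lie_ideal L br J \<Longrightarrow> J = {\<zero>\<^bsub>L\<^esub>} \<or> J = carrier L"

text \<open>The Lie algebra axioms for \<open>(L, br)\<close> are deliberately not part of the following predicate:
  below \<open>L\<close> is always known to be a Lie algebra, by assumption or by construction.\<close>

locale lie_module = Module.module complex_field V
  for L :: "(complex, 'a) module" and br :: "'a \<Rightarrow> 'a \<Rightarrow> 'a"
    and V :: "(complex, 'v) module" (structure) +
  fixes act :: "'a \<Rightarrow> 'v \<Rightarrow> 'v"
  assumes act_linear: "x \<in> carrier L \<Longrightarrow> linear_map V V (act x)"
    and act_add: "\<lbrakk>x \<in> carrier L; y \<in> carrier L; v \<in> carrier V\<rbrakk>
      \<Longrightarrow> act (x \<oplus>\<^bsub>L\<^esub> y) v = act x v \<oplus>\<^bsub>V\<^esub> act y v"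
    and act_smult: "\<lbrakk>x \<in> carrier L; v \<in> carrier V\<rbrakk>
      \<Longrightarrow> act (c \<odot>\<^bsub>L\<^esub> x) v = c \<odot>\<^bsub>V\<^esub> act x v"
    and act_br: "\<lbrakk>x \<in> carrier L; y \<in> carrier L; v \<in> carrier V\<rbrakk>
      \<Longrightarrow> act (br x y) v = act x (act y v) \<ominus>\<^bsub>V\<^esub> act y (act x v)"


section \<open>The normalized invariant form\<close>

fun lower_central :: "(complex, 'a) module \<Rightarrow> ('a \<Rightarrow> 'a \<Rightarrow> 'a) \<Rightarrow> 'a set \<Rightarrow> nat \<Rightarrow> 'a set" where
  "lower_central L br H 0 = H"
| "lower_central L br H (Suc n) = lin_span L {br x y |x y. x \<in> H \<and> y \<in> lower_central L br H n}"

definition cartan_subalgebra :: "(complex, 'a) module \<Rightarrow> ('a \<Rightarrow> 'a \<Rightarrow> 'a) \<Rightarrow> 'a set \<Rightarrow> bool" where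
  "cartan_subalgebra L br H \<longleftrightarrow>
     submodule H complex_field L \<and>
     (\<forall>x\<in>H. \<forall>y\<in>H. br x y \<in> H) \<and>
     (\<exists>n. lower_central L br H n = {\<zero>\<^bsub>L\<^esub>}) \<and>
     {x \<in> carrier L. \<forall>h\<in>H. br x h \<in> H} = H"

text \<open>Only the values of \<open>\<alpha>\<close> on \<open>H\<close> matter; its linearity there is automatic, since the root
  vector \<open>x\<close> is nonzero.\<close>

definition is_root ::
  "(complex, 'a) module \<Rightarrow> ('a \<Rightarrow> 'a \<Rightarrow> 'a) \<Rightarrow> 'a set \<Rightarrow> ('a \<Rightarrow> complex) \<Rightarrow> bool" where
  "is_root L br H \<alpha> \<longleftrightarrow>
     (\<exists>h\<in>H. \<alpha> h \<noteq> 0) \<and>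
     (\<exists>x\<in>carrier L. x \<noteq> \<zero>\<^bsub>L\<^esub> \<and> (\<forall>h\<in>H. br h x = \<alpha> h \<odot>\<^bsub>L\<^esub> x))"

text \<open>The squared length of a root \<open>\<alpha>\<close> is \<open>form t t\<close>, where \<open>t\<close> is the element of the Cartan
  subalgebra that represents \<open>\<alpha>\<close> with respect to the form.\<close>

definition root_square_lengths ::
  "(complex, 'a) module \<Rightarrow> ('a \<Rightarrow> 'a \<Rightarrow> 'a) \<Rightarrow> ('a \<Rightarrow> 'a \<Rightarrow> complex) \<Rightarrow> 'a set \<Rightarrow> complex set" where
  "root_square_lengths L br form H =
     {form t t |t \<alpha>. is_root L br H \<alpha> \<and> t \<in> H \<and> (\<forall>h\<in>H. form t h = \<alpha> h)}"

text \<open>As all Cartan subalgebras are conjugate, it does not matter which one is used to express the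
  normalization.\<close>

definition normalized_invariant_form ::
  "(complex, 'a) module \<Rightarrow> ('a \<Rightarrow> 'a \<Rightarrow> 'a) \<Rightarrow> ('a \<Rightarrow> 'a \<Rightarrow> complex) \<Rightarrow> bool" where
  "normalized_invariant_form L br form \<longleftrightarrow>
     (\<forall>x\<in>carrier L. \<forall>y\<in>carrier L. \<forall>w\<in>carrier L.
        form (x \<oplus>\<^bsub>L\<^esub> y) w = form x w + form y w) \<and>
     (\<forall>c. \<forall>x\<in>carrier L. \<forall>y\<in>carrier L. form (c \<odot>\<^bsub>L\<^esub> x) y = c * form x y) \<and>
     (\<forall>x\<in>carrier L. \<forall>y\<in>carrier L. form x y = form y x) \<and>
     (\<forall>x\<in>carrier L. \<forall>y\<in>carrier L. \<forall>w\<in>carrier L. form (br x y) w = form x (br y w)) \<and>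
     (\<forall>x\<in>carrier L. (\<forall>y\<in>carrier L. form x y = 0) \<longrightarrow> x = \<zero>\<^bsub>L\<^esub>) \<and>
     (\<exists>H. cartan_subalgebra L br H \<and>
        2 \<in> root_square_lengths L br form H \<and>
        (\<forall>l\<in>root_square_lengths L br form H. l \<in> \<real> \<and> Re l \<le> 2))"


section \<open>The twisted affine Lie algebra\<close>

definition lie_automorphism ::
  "(complex, 'a) module \<Rightarrow> ('a \<Rightarrow> 'a \<Rightarrow> 'a) \<Rightarrow> ('a \<Rightarrow> 'a) \<Rightarrow> bool" where
  "lie_automorphism L br \<sigma> \<longleftrightarrow>
     linear_map L L \<sigma> \<and> bij_betw \<sigma> (carrier L) (carrier L) \<and>
     (\<forall>x\<in>carrier L. \<forall>y\<in>carrier L. \<sigma> (br x y) = br (\<sigma> x) (\<sigma> y))"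

definition map_order :: "(complex, 'a) module \<Rightarrow> ('a \<Rightarrow> 'a) \<Rightarrow> nat \<Rightarrow> bool" where
  "map_order L \<sigma> N \<longleftrightarrow>
     0 < N \<and> (\<forall>x\<in>carrier L. (\<sigma> ^^ N) x = x) \<and>
     (\<forall>k. 0 < k \<and> k < N \<longrightarrow> (\<exists>x\<in>carrier L. (\<sigma> ^^ k) x \<noteq> x))"

definition eigenspace :: "(complex, 'a) module \<Rightarrow> ('a \<Rightarrow> 'a) \<Rightarrow> nat \<Rightarrow> nat \<Rightarrow> 'a set" where
  "eigenspace L \<sigma> N i =
     {a \<in> carrier L. \<sigma> a = (exp (2 * of_real pi * \<i> / of_nat N) ^ i) \<odot>\<^bsub>L\<^esub> a}"

text \<open>The components of \<open>a\<close> with respect to the decomposition of \<open>L\<close> into eigenspaces.\<close>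

definition eigen_component ::
  "(complex, 'a) module \<Rightarrow> ('a \<Rightarrow> 'a) \<Rightarrow> nat \<Rightarrow> 'a \<Rightarrow> nat \<Rightarrow> 'a" where
  "eigen_component L \<sigma> N a =
     (THE b. b \<in> (\<Pi>\<^sub>E i\<in>{..<N}. eigenspace L \<sigma> N i) \<and> a = (\<Oplus>\<^bsub>L\<^esub>i\<in>{..<N}. b i))"

text \<open>A pair \<open>(f, c)\<close> stands for the finite sum of the \<open>f k \<otimes> t\<^bsup>k/N\<^esup>\<close>, over all integers
  \<open>k\<close>, plus \<open>c\<close> times the central element. With \<open>k = n N + i\<close> and \<open>0 \<le> i < N\<close>, the
  coefficient \<open>f k\<close> has to lie in the \<open>i\<close>-th eigenspace.\<close>

type_synonym 'a affine = "(int \<Rightarrow> 'a) \<times> complex"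

definition twisted_affine ::
  "(complex, 'a) module \<Rightarrow> ('a \<Rightarrow> 'a) \<Rightarrow> nat \<Rightarrow> (complex, 'a affine) module" where
  "twisted_affine L \<sigma> N =
     \<lparr>carrier = {(f, c). finite {k. f k \<noteq> \<zero>\<^bsub>L\<^esub>} \<and>
                         (\<forall>k. f k \<in> eigenspace L \<sigma> N (nat (k mod int N)))},
      mult = undefined, one = undefined,
      zero = (\<lambda>k. \<zero>\<^bsub>L\<^esub>, 0),
      add = (\<lambda>(f, c) (g, d). (\<lambda>k. f k \<oplus>\<^bsub>L\<^esub> g k, c + d)),
      smult = (\<lambda>s (f, c). (\<lambda>k. s \<odot>\<^bsub>L\<^esub> f k, s * c))\<rparr>"

definition twisted_affine_br ::
  "(complex, 'a) module \<Rightarrow> ('a \<Rightarrow> 'a \<Rightarrow> 'a) \<Rightarrow> ('a \<Rightarrow> 'a \<Rightarrow> complex) \<Rightarrow> nat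
     \<Rightarrow> 'a affine \<Rightarrow> 'a affine \<Rightarrow> 'a affine" where
  "twisted_affine_br L br form N = (\<lambda>(f, c) (g, d).
     (\<lambda>k. \<Oplus>\<^bsub>L\<^esub>p\<in>{p. f p \<noteq> \<zero>\<^bsub>L\<^esub>}. br (f p) (g (k - p)),
      \<Sum>p\<in>{p. f p \<noteq> \<zero>\<^bsub>L\<^esub>}. of_int p / of_nat N * form (f p) (g (- p))))"

text \<open>The element \<open>a \<otimes> t\<^bsup>k/N\<^esup>\<close>, for \<open>a\<close> in the eigenspace of index \<open>k mod N\<close>.\<close>

definition loop_elem :: "(complex, 'a) module \<Rightarrow> 'a \<Rightarrow> int \<Rightarrow> 'a affine" where
  "loop_elem L a k = (\<lambda>p. if p = k then a else \<zero>\<^bsub>L\<^esub>, 0)"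


section \<open>Formal series and restricted modules\<close>

text \<open>A doubly infinite series in \<open>x\<^bsup>1/N\<^esup>\<close> is the function that maps an integer \<open>k\<close> to the
  coefficient of \<open>x\<^bsup>k/N\<^esup>\<close>.\<close>

type_synonym 'v op_series = "int \<Rightarrow> 'v \<Rightarrow> 'v"

text \<open>\<open>Hom(V, V((x\<^bsup>1/N\<^esup>)))\<close>, regarded as a set of series with coefficients in \<open>End V\<close>.\<close>

definition Hom_lower_truncated :: "(complex, 'v) module \<Rightarrow> 'v op_series set" where
  "Hom_lower_truncated V =
     {A. (\<forall>k. linear_map V V (A k)) \<and>
         (\<forall>v\<in>carrier V. \<exists>K. \<forall>k<K. A k v = \<zero>\<^bsub>V\<^esub>)}"

text \<open>In the series \<open>a(x)\<close>, the element \<open>a\<^sub>i \<otimes> t\<^bsup>n+i/N\<^esup>\<close> is the coefficient of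
  \<open>x\<^bsup>-n-i/N-1\<^esup> = x\<^bsup>k/N\<^esup>\<close>, that is, \<open>n N + i = - k - N\<close>.\<close>

definition gen_series ::
  "(complex, 'a) module \<Rightarrow> ('a \<Rightarrow> 'a) \<Rightarrow> nat \<Rightarrow> ('a affine \<Rightarrow> 'v \<Rightarrow> 'v) \<Rightarrow> 'a \<Rightarrow> 'v op_series" where
  "gen_series L \<sigma> N act a =
     (\<lambda>k. let p = - k - int N
          in act (loop_elem L (eigen_component L \<sigma> N a (nat (p mod int N))) p))"

text \<open>The product of a polynomial in \<open>x = (x\<^bsup>1/N\<^esup>)\<^bsup>N\<^esup>\<close> and a series in \<open>x\<^bsup>1/N\<^esup>\<close>.\<close>

definition poly_times_series ::
  "(complex, 'v) module \<Rightarrow> nat \<Rightarrow> complex poly \<Rightarrow> 'v op_series \<Rightarrow> 'v op_series" where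
  "poly_times_series V N p A =
     (\<lambda>k v. \<Oplus>\<^bsub>V\<^esub>m\<in>{..degree p}. coeff p m \<odot>\<^bsub>V\<^esub> A (k - int (N * m)) v)"

definition restricted_module ::
  "(complex, 'a) module \<Rightarrow> ('a \<Rightarrow> 'a \<Rightarrow> 'a) \<Rightarrow> ('a \<Rightarrow> 'a \<Rightarrow> complex) \<Rightarrow> ('a \<Rightarrow> 'a) \<Rightarrow> nat
     \<Rightarrow> (complex, 'v) module \<Rightarrow> ('a affine \<Rightarrow> 'v \<Rightarrow> 'v) \<Rightarrow> bool" where
  "restricted_module L br form \<sigma> N W act \<longleftrightarrow>
     lie_module (twisted_affine L \<sigma> N) (twisted_affine_br L br form N) W act \<and>
     (\<forall>a\<in>carrier L. gen_series L \<sigma> N act a \<in> Hom_lower_truncated W)"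


section \<open>Evaluation modules and tensor products\<close>

text \<open>The action on \<open>U(z)\<close>, whose underlying space is \<open>U\<close>. Here \<open>\<zeta>\<close> is the chosen \<open>N\<close>-th root
  of \<open>z\<close>, and \<open>z\<^bsup>n+i/N\<^esup> = z\<^bsup>n\<^esup> \<zeta>\<^bsup>i\<^esup>\<close>.\<close>

definition eval_act ::
  "(complex, 'a) module \<Rightarrow> nat \<Rightarrow> complex \<Rightarrow> complex \<Rightarrow> (complex, 'v) module
     \<Rightarrow> ('a \<Rightarrow> 'v \<Rightarrow> 'v) \<Rightarrow> 'a affine \<Rightarrow> 'v \<Rightarrow> 'v" where
  "eval_act L N z \<zeta> U act = (\<lambda>(f, c) u.
     \<Oplus>\<^bsub>U\<^esub>k\<in>{k. f k \<noteq> \<zero>\<^bsub>L\<^esub>}.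
       (z powi (k div int N) * \<zeta> ^ nat (k mod int N)) \<odot>\<^bsub>U\<^esub> act (f k) u)"

text \<open>The tensor product of a finite family of vector spaces is the free vector space on the
  tuples modulo the relations of multilinearity. All members of the family live in one type, but
  their carriers and operations are unrelated, so that every finite family of vector spaces is
  covered up to isomorphism.\<close>

definition tensor_relations ::
  "'i set \<Rightarrow> ('i \<Rightarrow> (complex, 'v) module) \<Rightarrow> (('i \<Rightarrow> 'v) \<Rightarrow> complex) set" where
  "tensor_relations I V =
     {\<lambda>b. free_gen (u(i := v \<oplus>\<^bsub>V i\<^esub> w)) b - free_gen (u(i := v)) b - free_gen (u(i := w)) b
        |u i v w. u \<in> (\<Pi>\<^sub>E j\<in>I. carrier (V j)) \<and> i \<in> I \<and> v \<in> carrier (V i) \<and> w \<in> carrier (V i)} \<union>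
     {\<lambda>b. free_gen (u(i := c \<odot>\<^bsub>V i\<^esub> v)) b - c * free_gen (u(i := v)) b
        |u i c v. u \<in> (\<Pi>\<^sub>E j\<in>I. carrier (V j)) \<and> i \<in> I \<and> v \<in> carrier (V i)}"

definition tensor_null ::
  "'i set \<Rightarrow> ('i \<Rightarrow> (complex, 'v) module) \<Rightarrow> (('i \<Rightarrow> 'v) \<Rightarrow> complex) set" where
  "tensor_null I V = lin_span (free_space (\<Pi>\<^sub>E j\<in>I. carrier (V j))) (tensor_relations I V)"

definition tensor_space ::
  "'i set \<Rightarrow> ('i \<Rightarrow> (complex, 'v) module) \<Rightarrow> (complex, (('i \<Rightarrow> 'v) \<Rightarrow> complex) set) module" where
  "tensor_space I V =
     quotient_space (free_space (\<Pi>\<^sub>E j\<in>I. carrier (V j))) (tensor_null I V)"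

text \<open>A Lie algebra element acts on tensors by the Leibniz rule: it maps the class of a tuple \<open>u\<close>
  to the sum of the classes of the tuples obtained from \<open>u\<close> by acting on one entry.\<close>

definition leibniz_act ::
  "'i set \<Rightarrow> ('i \<Rightarrow> 'b \<Rightarrow> 'v \<Rightarrow> 'v) \<Rightarrow> 'b \<Rightarrow> (('i \<Rightarrow> 'v) \<Rightarrow> complex) \<Rightarrow> ('i \<Rightarrow> 'v) \<Rightarrow> complex" where
  "leibniz_act I act x f =
     (\<lambda>b. \<Sum>u\<in>{u. f u \<noteq> 0}. f u * (\<Sum>i\<in>I. free_gen (u(i := act i x (u i))) b))"

definition tensor_act ::
  "'i set \<Rightarrow> ('i \<Rightarrow> (complex, 'v) module) \<Rightarrow> ('i \<Rightarrow> 'b \<Rightarrow> 'v \<Rightarrow> 'v) \<Rightarrow> 'b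
     \<Rightarrow> (('i \<Rightarrow> 'v) \<Rightarrow> complex) set \<Rightarrow> (('i \<Rightarrow> 'v) \<Rightarrow> complex) set" where
  "tensor_act I V act x A =
     (\<Union>f\<in>A. tensor_null I V +>\<^bsub>free_space (\<Pi>\<^sub>E j\<in>I. carrier (V j))\<^esub> leibniz_act I act x f)"

end

theory Submission
  imports Defs
begin

text \<open>On a factor \<open>U\<^sub>j(z\<^sub>j)\<close>, lowering the exponent of \<open>x\<close> by one multiplies the coefficient in
  \<open>a(x)\<close> by \<open>z\<^sub>j\<close>, so \<open>p(x) a(x) = p(z\<^sub>j) a(x)\<close> for every polynomial
  \<open>p\<close>; this vanishes when \<open>z\<^sub>j\<close> is a root of \<open>p\<close>. On the restricted factor \<open>W\<close>, a polynomial
  multiple of a lower truncated series is lower truncated. By the Leibniz rule, \<open>p(x) a(x)\<close> maps a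
  pure tensor to the sum of the tensors with one entry replaced by its image under \<open>p(x) a(x)\<close>, and
  every tensor is a finite sum of pure ones.\<close>

section \<open>Complex vector spaces and their quotients\<close>

text \<open>The tensor space is a quotient of the free space on tuples, and scalar multiplication
  and the Lie action send a coset to a union over all its representatives. Such a union is a single
  coset only if the operator on the free space respects the null subspace, so much of the work
  concerns \<open>tensor_null\<close>. The formula for p(x) a(x) on a pure tensor also holds only
  modulo \<open>tensor_null\<close>: on the free space the terms of p give separate tuples, and
  multilinearity merges them into one entry. Multiplying by polynomials in x rather than in x^(1/N)
  is what makes an evaluation factor behave like a scalar: a shift of the exponent by a multiple of
  N keeps the residue modulo N, hence the eigencomponent of a and the power of the chosen root of
  z_j, and changes only the integral power of z_j. On W the truncation bound depends on the vector;
  a common bound exists because a representative of a tensor has finite support and there are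
  finitely many factors.\<close>

lemma complex_field_simps [simp]:
  "carrier complex_field = UNIV" "mult complex_field = (*)" "one complex_field = 1"
  "zero complex_field = 0" "add complex_field = (+)"
  by (simp_all add: complex_field_def)

lemma cring_complex_field: "cring complex_field"
proof (rule cringI)
  show "abelian_group complex_field"
  proof (rule abelian_groupI)
    fix x assume "x \<in> carrier complex_field"
    show "\<exists>y\<in>carrier complex_field. y \<oplus>\<^bsub>complex_field\<^esub> x = \<zero>\<^bsub>complex_field\<^esub>"
      by (rule bexI[of _ "- x"]) simp_all
  qed simp_all
  show "comm_monoid complex_field"
    by (rule comm_monoidI) auto
qed (simp add: algebra_simps)

locale complex_space = Module.module complex_field V
  for V :: "(complex, 'v) module" (structure)
begin

lemma smult_add_left: "x \<in> carrier V \<Longrightarrow> (a + b) \<odot> x = a \<odot> x \<oplus>\<^bsub>V\<^esub> b \<odot> x"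
  using smult_l_distr[of a b x] by simp

lemma smult_smult: "x \<in> carrier V \<Longrightarrow> a \<odot> (b \<odot> x) = (a * b) \<odot> x"
  using smult_assoc1[of a b x] by simp

lemma smult_0_left [simp]: "x \<in> carrier V \<Longrightarrow> 0 \<odot> x = \<zero>\<^bsub>V\<^esub>"
  using smult_l_null[of x] by simp

lemma smult_1_left [simp]: "x \<in> carrier V \<Longrightarrow> 1 \<odot> x = x"
  using smult_one[of x] by simp

lemma complex_smult_closed [simp]: "x \<in> carrier V \<Longrightarrow> a \<odot> x \<in> carrier V"
  by (simp add: smult_closed)

lemma smult_0_right [simp]: "a \<odot> \<zero>\<^bsub>V\<^esub> = \<zero>\<^bsub>V\<^esub>"
  using smult_r_null[of a] by simp

lemma finsum_smult_left:
  assumes "finite A" "x \<in> carrier V"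
  shows "(\<Oplus>\<^bsub>V\<^esub>i\<in>A. c i \<odot> x) = (\<Sum>i\<in>A. c i) \<odot> x"
  using assms by (induction A) (simp_all add: smult_add_left M.finsum_insert Pi_def)

lemma finsum_smult_right:
  assumes "finite A" "f \<in> A \<rightarrow> carrier V"
  shows "(\<Oplus>\<^bsub>V\<^esub>i\<in>A. c \<odot> f i) = c \<odot> (\<Oplus>\<^bsub>V\<^esub>i\<in>A. f i)"
  using finsum_smult_ldistr[of A c f] assms by simp

lemma finsum_commute:
  assumes "finite A" "finite B" "\<And>i j. i \<in> A \<Longrightarrow> j \<in> B \<Longrightarrow> f i j \<in> carrier V"
  shows "(\<Oplus>\<^bsub>V\<^esub>i\<in>A. \<Oplus>\<^bsub>V\<^esub>j\<in>B. f i j) = (\<Oplus>\<^bsub>V\<^esub>j\<in>B. \<Oplus>\<^bsub>V\<^esub>i\<in>A. f i j)"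
  using assms(1,3)
proof (induction A)
  case (insert a A)
  then have "(\<Oplus>\<^bsub>V\<^esub>j\<in>B. \<Oplus>\<^bsub>V\<^esub>i\<in>insert a A. f i j) = (\<Oplus>\<^bsub>V\<^esub>j\<in>B. f a j \<oplus>\<^bsub>V\<^esub> (\<Oplus>\<^bsub>V\<^esub>i\<in>A. f i j))"
    by (intro M.finsum_cong') (auto simp: Pi_def M.finsum_insert intro!: M.add.m_closed M.finsum_closed)
  also have "\<dots> = (\<Oplus>\<^bsub>V\<^esub>j\<in>B. f a j) \<oplus>\<^bsub>V\<^esub> (\<Oplus>\<^bsub>V\<^esub>j\<in>B. \<Oplus>\<^bsub>V\<^esub>i\<in>A. f i j)"
    using insert by (intro M.finsum_addf) (auto simp: Pi_def intro!: M.finsum_closed)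
  also have "\<dots> = (\<Oplus>\<^bsub>V\<^esub>i\<in>insert a A. \<Oplus>\<^bsub>V\<^esub>j\<in>B. f i j)"
    using insert by (subst M.finsum_insert) (auto simp: Pi_def intro!: M.finsum_closed)
  finally show ?case ..
qed (simp add: M.finsum_zero)

end

lemma linear_mapD:
  assumes "linear_map V W f"
  shows "x \<in> carrier V \<Longrightarrow> f x \<in> carrier W"
    and "x \<in> carrier V \<Longrightarrow> y \<in> carrier V \<Longrightarrow> f (x \<oplus>\<^bsub>V\<^esub> y) = f x \<oplus>\<^bsub>W\<^esub> f y"
    and "x \<in> carrier V \<Longrightarrow> f (c \<odot>\<^bsub>V\<^esub> x) = c \<odot>\<^bsub>W\<^esub> f x"
  using assms by (auto simp: linear_map_def)

lemma linear_map_zero: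
  assumes "complex_space V" "complex_space W" "linear_map V W f"
  shows "f \<zero>\<^bsub>V\<^esub> = \<zero>\<^bsub>W\<^esub>"
proof -
  interpret V: complex_space V by fact
  interpret W: complex_space W by fact
  have "f (0 \<odot>\<^bsub>V\<^esub> \<zero>\<^bsub>V\<^esub>) = 0 \<odot>\<^bsub>W\<^esub> f \<zero>\<^bsub>V\<^esub>"
    by (rule linear_mapD(3)[OF assms(3)]) simp
  then show ?thesis
    using linear_mapD(1)[OF assms(3), of "\<zero>\<^bsub>V\<^esub>"] by simp
qed

lemma linear_map_finsum:
  assumes "complex_space V" "complex_space W" "linear_map V W f"
    and "finite A" "g \<in> A \<rightarrow> carrier V"
  shows "f (\<Oplus>\<^bsub>V\<^esub>i\<in>A. g i) = (\<Oplus>\<^bsub>W\<^esub>i\<in>A. f (g i))"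
proof -
  interpret V: complex_space V by fact
  interpret W: complex_space W by fact
  show ?thesis
    using assms(4,5)
    by (induction A)
      (auto simp: linear_map_zero[OF assms(1-3)] linear_mapD[OF assms(3)] Pi_def
        V.M.finsum_insert W.M.finsum_insert intro!: linear_mapD(2)[OF assms(3)] V.M.finsum_closed)
qed

text \<open>Coefficients of a polynomial multiple of a series and the averaging projections onto
  eigenspaces both have this shape.\<close>

lemma (in complex_space) linear_map_finsum_smult:
  assumes "finite A" "\<And>i. i \<in> A \<Longrightarrow> linear_map V V (f i)"
  shows "linear_map V V (\<lambda>v. \<Oplus>\<^bsub>V\<^esub>i\<in>A. c i \<odot> f i v)"
  unfolding linear_map_def
proof (intro conjI ballI allI)
  note D = linear_mapD[OF assms(2)]
  show "(\<lambda>v. \<Oplus>\<^bsub>V\<^esub>i\<in>A. c i \<odot> f i v) \<in> carrier V \<rightarrow> carrier V"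
    by (auto intro!: M.finsum_closed simp: D)
  fix x assume x: "x \<in> carrier V"
  show "(\<Oplus>\<^bsub>V\<^esub>i\<in>A. c i \<odot> f i (x \<oplus>\<^bsub>V\<^esub> y)) = (\<Oplus>\<^bsub>V\<^esub>i\<in>A. c i \<odot> f i x) \<oplus>\<^bsub>V\<^esub> (\<Oplus>\<^bsub>V\<^esub>i\<in>A. c i \<odot> f i y)"
    if y: "y \<in> carrier V" for y
  proof -
    have "(\<Oplus>\<^bsub>V\<^esub>i\<in>A. c i \<odot> f i (x \<oplus>\<^bsub>V\<^esub> y)) = (\<Oplus>\<^bsub>V\<^esub>i\<in>A. c i \<odot> f i x \<oplus>\<^bsub>V\<^esub> c i \<odot> f i y)"
      using x y by (intro M.finsum_cong') (auto simp: D smult_r_distr)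
    also have "\<dots> = (\<Oplus>\<^bsub>V\<^esub>i\<in>A. c i \<odot> f i x) \<oplus>\<^bsub>V\<^esub> (\<Oplus>\<^bsub>V\<^esub>i\<in>A. c i \<odot> f i y)"
      using x y by (intro M.finsum_addf) (auto simp: D)
    finally show ?thesis .
  qed
  show "(\<Oplus>\<^bsub>V\<^esub>i\<in>A. c i \<odot> f i (a \<odot> x)) = a \<odot> (\<Oplus>\<^bsub>V\<^esub>i\<in>A. c i \<odot> f i x)" for a
  proof -
    have "(\<Oplus>\<^bsub>V\<^esub>i\<in>A. c i \<odot> f i (a \<odot> x)) = (\<Oplus>\<^bsub>V\<^esub>i\<in>A. a \<odot> (c i \<odot> f i x))"
      using x by (intro M.finsum_cong') (auto simp: D smult_smult mult.commute)
    also have "\<dots> = a \<odot> (\<Oplus>\<^bsub>V\<^esub>i\<in>A. c i \<odot> f i x)"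
      using x assms(1) by (intro finsum_smult_right) (auto simp: D)
    finally show ?thesis .
  qed
qed

section \<open>Quotient by a submodule\<close>

context complex_space
begin

context
  fixes S
  assumes S: "submodule S complex_field V"
begin

lemma abelian_subgroup_of_submodule: "abelian_subgroup S V"
  by (intro abelian_subgroupI3 additive_subgroupI submodule.axioms(1)[OF S])
    (rule M.abelian_group_axioms)

interpretation S: abelian_subgroup S V
  by (rule abelian_subgroup_of_submodule)

interpretation S': submodule S complex_field V
  by (fact S)

abbreviation (input) "Q \<equiv> quotient_space V S"
abbreviation (input) "cls x \<equiv> S +>\<^bsub>V\<^esub> x"

lemma carrier_quotient: "carrier Q = cls ` carrier V"
  by (auto simp: quotient_space_def A_RCOSETS_def')

lemma add_quotient:
  "x \<in> carrier V \<Longrightarrow> y \<in> carrier V \<Longrightarrow> cls x \<oplus>\<^bsub>Q\<^esub> cls y = cls (x \<oplus>\<^bsub>V\<^esub> y)"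
  by (simp add: quotient_space_def S.a_rcos_sum)

lemma coset_eqI:
  assumes "x \<in> carrier V" "s \<in> S"
  shows "cls (s \<oplus>\<^bsub>V\<^esub> x) = cls x"
  by (rule M.a_repr_independence[symmetric])
    (use assms M.a_rcosI[of s S x] S.a_subset S.a_subgroup in auto)

lemma mem_cosetE:
  assumes "y \<in> cls x"
  obtains s where "s \<in> S" "y = s \<oplus>\<^bsub>V\<^esub> x"
  using assms by (auto simp: a_r_coset_def')

text \<open>Two representatives of a coset differ by some s in S, and c s is again in S. So all
  cosets in the union that defines the scalar multiple coincide, and the union is not empty because
  x lies in its own coset.\<close>

lemma smult_quotient:
  assumes "x \<in> carrier V"
  shows "c \<odot>\<^bsub>Q\<^esub> cls x = cls (c \<odot> x)"
proof -
  have "cls (c \<odot> y) = cls (c \<odot> x)" if y: "y \<in> cls x" for y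
  proof -
    obtain s where s: "s \<in> S" "y = s \<oplus>\<^bsub>V\<^esub> x"
      using mem_cosetE[OF y] .
    then have "c \<odot> y = c \<odot> s \<oplus>\<^bsub>V\<^esub> c \<odot> x"
      using assms S.a_subset by (auto intro!: smult_r_distr)
    then show ?thesis
      using s assms S'.smult_closed[of c s] by (simp add: coset_eqI)
  qed
  moreover have "x \<in> cls x"
    using assms by (rule S.a_rcos_self)
  ultimately have "(\<Union>y\<in>cls x. cls (c \<odot> y)) = cls (c \<odot> x)"
    by blast
  then show ?thesis
    by (simp add: quotient_space_def)
qed

lemma zero_quotient: "\<zero>\<^bsub>Q\<^esub> = cls \<zero>\<^bsub>V\<^esub>"
  using S.a_subset by (simp add: quotient_space_def)

lemma coset_eq_zero: "x \<in> S \<Longrightarrow> cls x = \<zero>\<^bsub>Q\<^esub>"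
  using coset_eqI[of "\<zero>\<^bsub>V\<^esub>" x] S.a_subset by (auto simp: zero_quotient)

lemma complex_space_quotient: "complex_space Q"
  unfolding complex_space_def
proof (rule moduleI)
  show "abelian_group Q"
  proof (rule abelian_groupI)
    fix X Y assume "X \<in> carrier Q" "Y \<in> carrier Q"
    then obtain x y where [simp]: "x \<in> carrier V" "X = cls x" "y \<in> carrier V" "Y = cls y"
      by (auto simp: carrier_quotient)
    show "X \<oplus>\<^bsub>Q\<^esub> Y \<in> carrier Q"
      by (simp add: carrier_quotient add_quotient)
    show "X \<oplus>\<^bsub>Q\<^esub> Y = Y \<oplus>\<^bsub>Q\<^esub> X"
      by (simp add: add_quotient M.a_comm)
    fix Z assume "Z \<in> carrier Q"
    then obtain w where [simp]: "w \<in> carrier V" "Z = cls w"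
      by (auto simp: carrier_quotient)
    show "X \<oplus>\<^bsub>Q\<^esub> Y \<oplus>\<^bsub>Q\<^esub> Z = X \<oplus>\<^bsub>Q\<^esub> (Y \<oplus>\<^bsub>Q\<^esub> Z)"
      by (simp add: add_quotient M.a_assoc)
  next
    fix X assume "X \<in> carrier Q"
    then obtain x where [simp]: "x \<in> carrier V" "X = cls x"
      by (auto simp: carrier_quotient)
    show "\<zero>\<^bsub>Q\<^esub> \<oplus>\<^bsub>Q\<^esub> X = X"
      by (simp add: add_quotient zero_quotient)
    show "\<exists>Y\<in>carrier Q. Y \<oplus>\<^bsub>Q\<^esub> X = \<zero>\<^bsub>Q\<^esub>"
      by (intro bexI[of _ "cls (\<ominus>\<^bsub>V\<^esub> x)"])
        (simp_all add: carrier_quotient add_quotient zero_quotient M.l_neg)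
  qed (simp add: carrier_quotient zero_quotient)
next
  fix a X assume "X \<in> carrier Q"
  then obtain x where [simp]: "x \<in> carrier V" "X = cls x"
    by (auto simp: carrier_quotient)
  show "a \<odot>\<^bsub>Q\<^esub> X \<in> carrier Q"
    by (simp add: carrier_quotient smult_quotient)
  show "(a \<oplus>\<^bsub>complex_field\<^esub> b) \<odot>\<^bsub>Q\<^esub> X = a \<odot>\<^bsub>Q\<^esub> X \<oplus>\<^bsub>Q\<^esub> b \<odot>\<^bsub>Q\<^esub> X" for b
    by (simp add: smult_quotient add_quotient smult_add_left)
  show "(a \<otimes>\<^bsub>complex_field\<^esub> b) \<odot>\<^bsub>Q\<^esub> X = a \<odot>\<^bsub>Q\<^esub> (b \<odot>\<^bsub>Q\<^esub> X)" for b
    by (simp add: smult_quotient smult_smult)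
  show "\<one>\<^bsub>complex_field\<^esub> \<odot>\<^bsub>Q\<^esub> X = X"
    by (simp add: smult_quotient)
  fix Y assume "Y \<in> carrier Q"
  then obtain y where [simp]: "y \<in> carrier V" "Y = cls y"
    by (auto simp: carrier_quotient)
  show "a \<odot>\<^bsub>Q\<^esub> (X \<oplus>\<^bsub>Q\<^esub> Y) = a \<odot>\<^bsub>Q\<^esub> X \<oplus>\<^bsub>Q\<^esub> a \<odot>\<^bsub>Q\<^esub> Y"
    by (simp add: smult_quotient add_quotient smult_r_distr)
qed (rule cring_complex_field)

lemma finsum_quotient:
  assumes "finite A" "f \<in> A \<rightarrow> carrier V"
  shows "(\<Oplus>\<^bsub>Q\<^esub>i\<in>A. cls (f i)) = cls (\<Oplus>\<^bsub>V\<^esub>i\<in>A. f i)"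
proof -
  have "linear_map V Q cls"
    by (auto simp: linear_map_def carrier_quotient add_quotient smult_quotient)
  from linear_map_finsum[OF complex_space_axioms complex_space_quotient this assms]
  show ?thesis by simp
qed

end

end

section \<open>Submodules and linear spans\<close>

context complex_space
begin

lemma minus_eq_smult: "x \<in> carrier V \<Longrightarrow> \<ominus>\<^bsub>V\<^esub> x = (- 1) \<odot> x"
  using smult_add_left[of x "- 1" 1] by (intro M.minus_equality) simp_all

lemma complex_submoduleI:
  assumes "S \<subseteq> carrier V" "\<zero>\<^bsub>V\<^esub> \<in> S"
    and "\<And>x y. x \<in> S \<Longrightarrow> y \<in> S \<Longrightarrow> x \<oplus>\<^bsub>V\<^esub> y \<in> S"
    and "\<And>c x. x \<in> S \<Longrightarrow> c \<odot> x \<in> S"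
  shows "submodule S complex_field V"
  using assms by (intro submoduleI) (auto simp: minus_eq_smult subset_iff)

lemma submodule_zero: "submodule S complex_field V \<Longrightarrow> \<zero>\<^bsub>V\<^esub> \<in> S"
  using subgroup.one_closed[of S "add_monoid V"] by (simp add: submodule_def)

lemma lin_span_superset: "X \<subseteq> lin_span V X"
  by (auto simp: lin_span_def)

lemma lin_span_least: "submodule S complex_field V \<Longrightarrow> X \<subseteq> S \<Longrightarrow> lin_span V X \<subseteq> S"
  by (auto simp: lin_span_def)

lemma submodule_lin_span:
  assumes "X \<subseteq> carrier V"
  shows "submodule (lin_span V X) complex_field V"
proof (rule complex_submoduleI)
  show "lin_span V X \<subseteq> carrier V"
    using assms by (intro lin_span_least carrier_is_submodule)
qed (auto simp: lin_span_def submodule_zero intro: submodule.smult_closed dest: submoduleE(5))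

end

section \<open>Tensor products\<close>

lemma complex_space_free_space: "complex_space (free_space B)"
  unfolding complex_space_def
proof (rule moduleI)
  show "abelian_group (free_space B)"
  proof (rule abelian_groupI)
    fix f g assume "f \<in> carrier (free_space B)" "g \<in> carrier (free_space B)"
    moreover have "{b. f b + g b \<noteq> 0} \<subseteq> {b. f b \<noteq> 0} \<union> {b. g b \<noteq> 0}"
      by auto
    ultimately show "f \<oplus>\<^bsub>free_space B\<^esub> g \<in> carrier (free_space B)"
      by (auto simp: free_space_def intro: finite_subset)
  next
    fix f assume "f \<in> carrier (free_space B)"
    then show "\<exists>g\<in>carrier (free_space B). g \<oplus>\<^bsub>free_space B\<^esub> f = \<zero>\<^bsub>free_space B\<^esub>"
      by (intro bexI[of _ "\<lambda>b. - f b"]) (auto simp: free_space_def)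
  qed (simp_all add: free_space_def algebra_simps)
next
  fix a f assume "f \<in> carrier (free_space B)"
  moreover have "{b. a * f b \<noteq> 0} \<subseteq> {b. f b \<noteq> 0}"
    by auto
  ultimately show "a \<odot>\<^bsub>free_space B\<^esub> f \<in> carrier (free_space B)"
    by (auto simp: free_space_def intro: finite_subset)
qed (simp_all add: free_space_def algebra_simps cring_complex_field)

abbreviation tuples :: "'i set \<Rightarrow> ('i \<Rightarrow> (complex, 'v) module) \<Rightarrow> ('i \<Rightarrow> 'v) set" where
  "tuples I V \<equiv> \<Pi>\<^sub>E j\<in>I. carrier (V j)"

lemma free_space_simps [simp]:
  "f \<oplus>\<^bsub>free_space B\<^esub> g = (\<lambda>b. f b + g b)"
  "c \<odot>\<^bsub>free_space B\<^esub> f = (\<lambda>b. c * f b)"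
  "\<zero>\<^bsub>free_space B\<^esub> = (\<lambda>b. 0)"
  by (simp_all add: free_space_def)

lemma mem_free_space: "f \<in> carrier (free_space B) \<longleftrightarrow> finite {b. f b \<noteq> 0} \<and> {b. f b \<noteq> 0} \<subseteq> B"
  by (simp add: free_space_def)

lemma free_gen_in_free_space: "u \<in> B \<Longrightarrow> free_gen u \<in> carrier (free_space B)"
  by (simp add: mem_free_space free_gen_def)

lemma free_space_submodule_closed:
  assumes "submodule S complex_field (free_space B)"
  shows "(\<lambda>b. 0) \<in> S"
    and "f \<in> S \<Longrightarrow> g \<in> S \<Longrightarrow> (\<lambda>b. f b + g b) \<in> S"
    and "f \<in> S \<Longrightarrow> (\<lambda>b. c * f b) \<in> S"
proof -
  interpret complex_space "free_space B"
    by (rule complex_space_free_space)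
  show "(\<lambda>b. 0) \<in> S"
    using submodule_zero[OF assms] by simp
  show "f \<in> S \<Longrightarrow> g \<in> S \<Longrightarrow> (\<lambda>b. f b + g b) \<in> S"
    using submoduleE(5)[OF assms, of f g] by simp
  show "f \<in> S \<Longrightarrow> (\<lambda>b. c * f b) \<in> S"
    using submoduleE(4)[OF assms, of c f] by simp
qed

lemma free_space_submodule_sum:
  assumes "submodule S complex_field (free_space B)"
    and "finite A" "\<And>i. i \<in> A \<Longrightarrow> f i \<in> S"
  shows "(\<lambda>b. \<Sum>i\<in>A. c i * f i b) \<in> S"
  using assms(2,3)
proof (induction A)
  case empty
  show ?case
    using free_space_submodule_closed(1)[OF assms(1)] by simp
next
  case (insert a A)
  then have "(\<lambda>b. c a * f a b) \<in> S" "(\<lambda>b. \<Sum>i\<in>A. c i * f i b) \<in> S"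
    by (auto intro: free_space_submodule_closed(3)[OF assms(1)])
  from free_space_submodule_closed(2)[OF assms(1) this] insert(1,2) show ?case
    by simp
qed

lemma finsum_free_space:
  assumes "finite A" "\<And>i. i \<in> A \<Longrightarrow> f i \<in> carrier (free_space B)"
  shows "(\<Oplus>\<^bsub>free_space B\<^esub>i\<in>A. f i) = (\<lambda>b. \<Sum>i\<in>A. f i b)"
proof -
  interpret complex_space "free_space B"
    by (rule complex_space_free_space)
  show ?thesis
    using assms by (induction A) (simp_all add: Pi_def M.finsum_insert)
qed

section \<open>The Leibniz operator on the free space\<close>

lemma leibniz_act_superset:
  assumes "finite S" "{u. f u \<noteq> 0} \<subseteq> S"
  shows "leibniz_act I act x f b = (\<Sum>u\<in>S. f u * (\<Sum>i\<in>I. free_gen (u(i := act i x (u i))) b))"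
  unfolding leibniz_act_def using assms by (intro sum.mono_neutral_left) auto

lemma leibniz_act_add:
  assumes "finite {u. f u \<noteq> 0}" "finite {u. g u \<noteq> 0}"
  shows "leibniz_act I act x (\<lambda>u. f u + g u) = (\<lambda>b. leibniz_act I act x f b + leibniz_act I act x g b)"
proof
  fix b
  \<comment> \<open>Cancellation can make the support of the sum smaller than this union, so all
    three sums are extended to the union by zero terms.\<close>
  let ?S = "{u. f u \<noteq> 0} \<union> {u. g u \<noteq> 0}"
  have "finite ?S"
    using assms by simp
  then show "leibniz_act I act x (\<lambda>u. f u + g u) b = leibniz_act I act x f b + leibniz_act I act x g b"
    by (subst (1 2 3) leibniz_act_superset[of ?S]) (auto simp: distrib_right sum.distrib)
qed

lemma leibniz_act_smult:
  assumes "finite {u. f u \<noteq> 0}"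
  shows "leibniz_act I act x (\<lambda>u. c * f u) = (\<lambda>b. c * leibniz_act I act x f b)"
proof
  fix b
  show "leibniz_act I act x (\<lambda>u. c * f u) b = c * leibniz_act I act x f b"
    using assms
    by (subst (1 2) leibniz_act_superset[of "{u. f u \<noteq> 0}"]) (auto simp: sum_distrib_left mult.assoc)
qed

lemma leibniz_act_free_gen:
  "leibniz_act I act x (free_gen u) = (\<lambda>b. \<Sum>i\<in>I. free_gen (u(i := act i x (u i))) b)"
  by (rule ext, subst leibniz_act_superset[of "{u}"]) (auto simp: free_gen_def)

section \<open>Polynomial multiples of operator series\<close>

lemma poly_times_series_linear:
  assumes "complex_space V" "\<And>k. linear_map V V (A k)"
  shows "linear_map V V (poly_times_series V N p A k)"
  unfolding poly_times_series_def
  by (rule complex_space.linear_map_finsum_smult) (use assms in auto)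

text \<open>The k-th coefficient of the product reads the series only at indices at most k, so the
  bound K for the series serves for the product as well.\<close>

lemma poly_times_series_lower_truncated:
  assumes "complex_space V" "A \<in> Hom_lower_truncated V" "v \<in> carrier V"
  shows "\<exists>K. \<forall>k<K. poly_times_series V N p A k v = \<zero>\<^bsub>V\<^esub>"
proof -
  interpret complex_space V by fact
  obtain K where K: "\<And>k. k < K \<Longrightarrow> A k v = \<zero>\<^bsub>V\<^esub>"
    using assms(2,3) unfolding Hom_lower_truncated_def by blast
  have "A (k - int (N * m)) v = \<zero>\<^bsub>V\<^esub>" if "k < K" for k m
    using that K[of "k - int (N * m)"] of_nat_0_le_iff[of "N * m", where 'a = int] by linarith
  then show ?thesis
    unfolding poly_times_series_def by (intro exI[of _ K] allI impI M.add.finprod_one_eqI) simp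
qed

text \<open>If stepping down by N multiplies the coefficient by z, the k-th coefficient of the
  product collapses to the scalar p(z) times \<open>A k v\<close>.\<close>

lemma poly_times_series_eq_zero:
  assumes "complex_space V" "A k v \<in> carrier V"
    and "\<And>m. A (k - int (N * m)) v = z ^ m \<odot>\<^bsub>V\<^esub> A k v" and "poly p z = 0"
  shows "poly_times_series V N p A k v = \<zero>\<^bsub>V\<^esub>"
proof -
  interpret complex_space V by fact
  have "poly_times_series V N p A k v = (\<Oplus>\<^bsub>V\<^esub>m\<in>{..degree p}. (coeff p m * z ^ m) \<odot>\<^bsub>V\<^esub> A k v)"
    by (simp add: poly_times_series_def assms(2,3) smult_smult del: of_nat_mult)
  also have "\<dots> = (\<Sum>m\<le>degree p. coeff p m * z ^ m) \<odot>\<^bsub>V\<^esub> A k v"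
    by (rule finsum_smult_left) (simp_all add: assms(2))
  also have "(\<Sum>m\<le>degree p. coeff p m * z ^ m) = 0"
    using assms(4) by (simp add: poly_altdef)
  finally show ?thesis
    using assms(2) by simp
qed

section \<open>Multilinearity relations and the action on the tensor space\<close>

locale tensor_family =
  fixes I :: "'i set" and V :: "'i \<Rightarrow> (complex, 'v) module"
  assumes finite_index: "finite I"
    and factor_space: "i \<in> I \<Longrightarrow> complex_space (V i)"
begin

abbreviation (input) "F \<equiv> free_space (tuples I V)"
abbreviation (input) "null \<equiv> tensor_null I V"

sublocale F: complex_space F
  by (rule complex_space_free_space)

lemma update_tuple: "u \<in> tuples I V \<Longrightarrow> i \<in> I \<Longrightarrow> v \<in> carrier (V i) \<Longrightarrow> u(i := v) \<in> tuples I V"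
  using PiE_fun_upd[of v "\<lambda>j. carrier (V j)" i u I] by (simp add: insert_absorb)

lemma tuple_component: "u \<in> tuples I V \<Longrightarrow> i \<in> I \<Longrightarrow> u i \<in> carrier (V i)"
  by (rule PiE_mem)

lemma tensor_relations_subset: "tensor_relations I V \<subseteq> carrier F"
proof -
  have add: "(\<lambda>b. free_gen u b - free_gen v b - free_gen w b) \<in> carrier F"
    if "u \<in> tuples I V" "v \<in> tuples I V" "w \<in> tuples I V" for u v w
  proof -
    have "{b. free_gen u b - free_gen v b - free_gen w b \<noteq> (0::complex)} \<subseteq> {u, v, w}"
      by (auto simp: free_gen_def split: if_splits)
    with that show ?thesis
      unfolding mem_free_space by (auto intro: finite_subset)
  qed
  have smult: "(\<lambda>b. free_gen u b - c * free_gen v b) \<in> carrier F"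
    if "u \<in> tuples I V" "v \<in> tuples I V" for u v c
  proof -
    have "{b. free_gen u b - c * free_gen v b \<noteq> 0} \<subseteq> {u, v}"
      by (auto simp: free_gen_def split: if_splits)
    with that show ?thesis
      unfolding mem_free_space by (auto intro: finite_subset)
  qed
  have "v \<oplus>\<^bsub>V i\<^esub> w \<in> carrier (V i)"
    if "i \<in> I" "v \<in> carrier (V i)" "w \<in> carrier (V i)" for i v w
    using factor_space[OF that(1)] that
    by (simp add: complex_space_def Module.module_def abelian_group_def abelian_monoid.a_closed)
  moreover have "c \<odot>\<^bsub>V i\<^esub> v \<in> carrier (V i)" if "i \<in> I" "v \<in> carrier (V i)" for i c v
    using factor_space[OF that(1)] that by (simp add: complex_space.complex_smult_closed)
  ultimately show ?thesis
    unfolding tensor_relations_def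
    by (intro Un_least subsetI; elim CollectE exE conjE; hypsubst) (intro add smult update_tuple; simp)+
qed

lemma submodule_tensor_null: "submodule null complex_field F"
  unfolding tensor_null_def by (rule F.submodule_lin_span[OF tensor_relations_subset])

lemmas null_closed = free_space_submodule_closed[OF submodule_tensor_null]
lemmas null_sum = free_space_submodule_sum[OF submodule_tensor_null]

lemma null_in_free_space: "f \<in> null \<Longrightarrow> f \<in> carrier F"
  using F.submoduleE(1)[OF submodule_tensor_null] by blast

lemma null_add_relation:
  assumes "u \<in> tuples I V" "i \<in> I" "v \<in> carrier (V i)" "w \<in> carrier (V i)"
  shows "(\<lambda>b. free_gen (u(i := v \<oplus>\<^bsub>V i\<^esub> w)) b - free_gen (u(i := v)) b - free_gen (u(i := w)) b) \<in> null"
  unfolding tensor_null_def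
  by (rule subsetD[OF F.lin_span_superset]) (use assms in \<open>force simp: tensor_relations_def\<close>)

lemma null_smult_relation:
  assumes "u \<in> tuples I V" "i \<in> I" "v \<in> carrier (V i)"
  shows "(\<lambda>b. free_gen (u(i := c \<odot>\<^bsub>V i\<^esub> v)) b - c * free_gen (u(i := v)) b) \<in> null"
  unfolding tensor_null_def
  by (rule subsetD[OF F.lin_span_superset]) (use assms in \<open>force simp: tensor_relations_def\<close>)

lemma null_zero_slot:
  assumes "u \<in> tuples I V" "i \<in> I"
  shows "free_gen (u(i := \<zero>\<^bsub>V i\<^esub>)) \<in> null"
proof -
  interpret complex_space "V i" using assms by (intro factor_space)
  show ?thesis
    using null_smult_relation[OF assms, of "\<zero>\<^bsub>V i\<^esub>" 0] by simp
qed

text \<open>Multilinearity for an arbitrary finite linear combination in one slot, obtained by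
  induction from the two kinds of generating relations. The empty combination is a zero slot, which
  is null by the scalar relation with factor 0.\<close>

lemma null_finsum_relation:
  assumes "u \<in> tuples I V" "i \<in> I" "finite A" "\<And>m. m \<in> A \<Longrightarrow> w m \<in> carrier (V i)"
  shows "(\<lambda>b. free_gen (u(i := \<Oplus>\<^bsub>V i\<^esub>m\<in>A. c m \<odot>\<^bsub>V i\<^esub> w m)) b - (\<Sum>m\<in>A. c m * free_gen (u(i := w m)) b)) \<in> null"
  using assms(3,4)
proof (induction A)
  case empty
  interpret complex_space "V i" using assms by (intro factor_space)
  show ?case
    using null_zero_slot[OF assms(1,2)] by (simp add: fun_upd_def)
next
  case (insert a A)
  interpret complex_space "V i" using assms by (intro factor_space)
  let ?v = "c a \<odot>\<^bsub>V i\<^esub> w a" and ?s = "\<Oplus>\<^bsub>V i\<^esub>m\<in>A. c m \<odot>\<^bsub>V i\<^esub> w m"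
  have s: "?s \<in> carrier (V i)"
    using insert by (intro M.finsum_closed) auto
  have eq: "(\<Oplus>\<^bsub>V i\<^esub>m\<in>insert a A. c m \<odot>\<^bsub>V i\<^esub> w m) = ?v \<oplus>\<^bsub>V i\<^esub> ?s"
    using insert by (intro M.finsum_insert) auto
  have IH: "(\<lambda>b. free_gen (u(i := ?s)) b - (\<Sum>m\<in>A. c m * free_gen (u(i := w m)) b)) \<in> null"
    using insert by blast
  have a: "w a \<in> carrier (V i)"
    using insert by blast
  \<comment> \<open>An additive relation, a scalar relation and the induction hypothesis; the
    generators with entries \<open>?v\<close> and \<open>?s\<close> cancel in the sum.\<close>
  have "(\<lambda>b. (free_gen (u(i := ?v \<oplus>\<^bsub>V i\<^esub> ?s)) b - free_gen (u(i := ?v)) b - free_gen (u(i := ?s)) b)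
      + ((free_gen (u(i := ?v)) b - c a * free_gen (u(i := w a)) b)
      + (free_gen (u(i := ?s)) b - (\<Sum>m\<in>A. c m * free_gen (u(i := w m)) b)))) \<in> null"
    by (intro null_closed(2) null_add_relation null_smult_relation IH assms(1,2) a s complex_smult_closed)
  then show ?case
    using insert(1,2) by (simp add: eq algebra_simps fun_upd_def)
qed

text \<open>This carries the vanishing of a coefficient of p(x) a(x) on one factor over to tensors:
  with the scalars \<open>c m\<close> taken to be the coefficients of p, the separate tuples add up
  to a null element.\<close>

lemma null_zero_slot_sum:
  assumes "u \<in> tuples I V" "i \<in> I" "finite A" "\<And>m. m \<in> A \<Longrightarrow> w m \<in> carrier (V i)"
    and "(\<Oplus>\<^bsub>V i\<^esub>m\<in>A. c m \<odot>\<^bsub>V i\<^esub> w m) = \<zero>\<^bsub>V i\<^esub>"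
  shows "(\<lambda>b. \<Sum>m\<in>A. c m * free_gen (u(i := w m)) b) \<in> null"
proof -
  have "(\<lambda>b. free_gen (u(i := \<zero>\<^bsub>V i\<^esub>)) b + - 1 * (free_gen (u(i := \<zero>\<^bsub>V i\<^esub>)) b
      - (\<Sum>m\<in>A. c m * free_gen (u(i := w m)) b))) \<in> null"
    using null_finsum_relation[OF assms(1-3), of w c, OF assms(4)] null_zero_slot[OF assms(1,2)]
    unfolding assms(5) by (intro null_closed(2,3))
  then show ?thesis by simp
qed

lemma leibniz_act_closed:
  assumes "f \<in> carrier F" "\<And>i. i \<in> I \<Longrightarrow> linear_map (V i) (V i) (act i x)"
  shows "leibniz_act I act x f \<in> carrier F"
proof -
  have "(\<lambda>b. \<Sum>i\<in>I. 1 * free_gen (u(i := act i x (u i))) b) \<in> carrier F" if "f u \<noteq> 0" for u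
    using that assms finite_index
    by (intro free_space_submodule_sum[OF F.carrier_is_submodule] free_gen_in_free_space update_tuple
      linear_mapD(1)[OF assms(2)] tuple_component) (auto simp: mem_free_space)
  then show ?thesis
    unfolding leibniz_act_def using assms(1)
    by (intro free_space_submodule_sum[OF F.carrier_is_submodule]) (auto simp: mem_free_space)
qed

text \<open>The elements that the operator sends into the null space form a submodule, so the
  generating relations suffice. For a relation in slot i, the Leibniz term at i is the same kind of
  relation between the images, by linearity of the action. The term at another slot j is the
  original relation for the tuple whose j-th entry has been acted on, since updates at different
  slots commute.\<close>

lemma leibniz_act_null:
  assumes "f \<in> null" and lin: "\<And>i. i \<in> I \<Longrightarrow> linear_map (V i) (V i) (act i x)"
  shows "leibniz_act I act x f \<in> null"
proof -
  let ?D = "leibniz_act I act x"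
  let ?A = "\<lambda>i. act i x"
  note A = linear_mapD[OF lin]
  have sub: "submodule {f \<in> carrier F. ?D f \<in> null} complex_field F"
  proof (rule F.complex_submoduleI)
    fix f g assume "f \<in> {f \<in> carrier F. ?D f \<in> null}" "g \<in> {f \<in> carrier F. ?D f \<in> null}"
    then show "f \<oplus>\<^bsub>F\<^esub> g \<in> {f \<in> carrier F. ?D f \<in> null}"
      using F.M.a_closed[of f g] null_closed(2)[of "?D f" "?D g"]
      by (auto simp: mem_free_space leibniz_act_add)
  next
    fix f c assume "f \<in> {f \<in> carrier F. ?D f \<in> null}"
    then show "c \<odot>\<^bsub>F\<^esub> f \<in> {f \<in> carrier F. ?D f \<in> null}"
      using F.complex_smult_closed[of f c] null_closed(3)[of "?D f" c]
      by (auto simp: mem_free_space leibniz_act_smult)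
  next
    show "\<zero>\<^bsub>F\<^esub> \<in> {f \<in> carrier F. ?D f \<in> null}"
      using null_closed(1) F.M.zero_closed by (auto simp: leibniz_act_def)
  qed auto
  have fin: "finite {b. free_gen u b \<noteq> (0::complex)}" "finite {b. c * free_gen u b \<noteq> (0::complex)}"
    for u :: "'i \<Rightarrow> 'v" and c
    by (auto simp: free_gen_def)
  \<comment> \<open>covers both kinds of generators of \<open>tensor_relations\<close>: the second has \<open>d = 0\<close>\<close>
  have combination: "?D (\<lambda>b. free_gen u b + (c * free_gen v b + d * free_gen w b))
      = (\<lambda>b. \<Sum>i\<in>I. 1 * (free_gen (u(i := ?A i (u i))) b + (c * free_gen (v(i := ?A i (v i))) b
          + d * free_gen (w(i := ?A i (w i))) b)))" for u v w c d
  proof -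
    have "finite {b. c * free_gen v b + d * free_gen w b \<noteq> (0::complex)}"
      by (rule finite_subset[of _ "{v, w}"]) (auto simp: free_gen_def)
    then show ?thesis
      by (simp add: leibniz_act_add leibniz_act_smult fin leibniz_act_free_gen sum.distrib sum_distrib_left)
  qed
  have rel: "?D f \<in> null" if "f \<in> tensor_relations I V" for f
    using that unfolding tensor_relations_def
  proof (elim UnE CollectE exE conjE)
    fix u i v w
    assume f: "f = (\<lambda>b. free_gen (u(i := v \<oplus>\<^bsub>V i\<^esub> w)) b - free_gen (u(i := v)) b - free_gen (u(i := w)) b)"
      and u: "u \<in> tuples I V" "i \<in> I" and v: "v \<in> carrier (V i)" "w \<in> carrier (V i)"
    \<comment> \<open>The j-th Leibniz term of the relation, with the signs written as factors so
      that it matches \<open>combination\<close>.\<close>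
    define h where "h j = (\<lambda>b. free_gen ((u(i := v \<oplus>\<^bsub>V i\<^esub> w))(j := ?A j ((u(i := v \<oplus>\<^bsub>V i\<^esub> w)) j))) b
        + (- 1 * free_gen ((u(i := v))(j := ?A j ((u(i := v)) j))) b
        + - 1 * free_gen ((u(i := w))(j := ?A j ((u(i := w)) j))) b))" for j
    have h: "h j \<in> null" if j: "j \<in> I" for j
    proof (cases "j = i")
      case True
      show ?thesis
        using null_add_relation[OF u, of "?A i v" "?A i w"] u v
        by (simp add: h_def True A algebra_simps)
    next
      case False
      then show ?thesis
        using null_add_relation[OF update_tuple[OF u(1) j] u(2) v, of "?A j (u j)"] j
          A(1)[OF j tuple_component[OF u(1) j]]
        by (simp add: h_def fun_upd_twist algebra_simps)
    qed
    have "f = (\<lambda>b. free_gen (u(i := v \<oplus>\<^bsub>V i\<^esub> w)) b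
        + (- 1 * free_gen (u(i := v)) b + - 1 * free_gen (u(i := w)) b))"
      by (simp add: f algebra_simps)
    then have "?D f = (\<lambda>b. \<Sum>j\<in>I. 1 * h j b)"
      by (simp only: combination h_def)
    then show "?D f \<in> null"
      using null_sum[OF finite_index, of h "\<lambda>_. 1"] h by simp
  next
    fix u i c v
    assume f: "f = (\<lambda>b. free_gen (u(i := c \<odot>\<^bsub>V i\<^esub> v)) b - c * free_gen (u(i := v)) b)"
      and u: "u \<in> tuples I V" "i \<in> I" and v: "v \<in> carrier (V i)"
    define h where "h j = (\<lambda>b. free_gen ((u(i := c \<odot>\<^bsub>V i\<^esub> v))(j := ?A j ((u(i := c \<odot>\<^bsub>V i\<^esub> v)) j))) b
        + (- c * free_gen ((u(i := v))(j := ?A j ((u(i := v)) j))) b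
        + 0 * free_gen ((u(i := v))(j := ?A j ((u(i := v)) j))) b))" for j
    have h: "h j \<in> null" if j: "j \<in> I" for j
    proof (cases "j = i")
      case True
      show ?thesis
        using null_smult_relation[OF u, of "?A i v" c] u v by (simp add: h_def True A)
    next
      case False
      then show ?thesis
        using null_smult_relation[OF update_tuple[OF u(1) j] u(2) v, of "?A j (u j)" c] j
          A(1)[OF j tuple_component[OF u(1) j]]
        by (simp add: h_def fun_upd_twist algebra_simps)
    qed
    have "f = (\<lambda>b. free_gen (u(i := c \<odot>\<^bsub>V i\<^esub> v)) b
        + (- c * free_gen (u(i := v)) b + 0 * free_gen (u(i := v)) b))"
      by (simp add: f)
    then have "?D f = (\<lambda>b. \<Sum>j\<in>I. 1 * h j b)"
      by (simp only: combination h_def)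
    then show "?D f \<in> null"
      using null_sum[OF finite_index, of h "\<lambda>_. 1"] h by simp
  qed
  have "null \<subseteq> {f \<in> carrier F. ?D f \<in> null}"
    unfolding tensor_null_def[of I V]
    by (rule F.lin_span_least[OF sub[unfolded tensor_null_def]])
      (use rel tensor_relations_subset in \<open>auto simp: tensor_null_def\<close>)
  with assms(1) show ?thesis by blast
qed

abbreviation (input) "cls f \<equiv> null +>\<^bsub>F\<^esub> f"

lemmas carrier_tensor_space =
  F.carrier_quotient[OF submodule_tensor_null, folded tensor_space_def]
lemmas add_tensor_space =
  F.add_quotient[OF submodule_tensor_null, folded tensor_space_def]
lemmas smult_tensor_space =
  F.smult_quotient[OF submodule_tensor_null, folded tensor_space_def]
lemmas finsum_tensor_space =
  F.finsum_quotient[OF submodule_tensor_null, folded tensor_space_def]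
lemmas coset_eq_zero_tensor_space =
  F.coset_eq_zero[OF submodule_tensor_null, folded tensor_space_def]
lemmas complex_space_tensor_space =
  F.complex_space_quotient[OF submodule_tensor_null, folded tensor_space_def]

context
  fixes act :: "'i \<Rightarrow> 'b \<Rightarrow> 'v \<Rightarrow> 'v" and x :: 'b
  assumes lin: "\<And>i. i \<in> I \<Longrightarrow> linear_map (V i) (V i) (act i x)"
begin

text \<open>Representatives of a coset differ by null elements, and \<open>leibniz_act_null\<close>
  keeps these null; hence the union in \<open>tensor_act\<close> is one coset.\<close>

lemma tensor_act_coset:
  assumes f: "f \<in> carrier F"
  shows "tensor_act I V act x (cls f) = cls (leibniz_act I act x f)"
proof -
  have "cls (leibniz_act I act x g) = cls (leibniz_act I act x f)" if "g \<in> cls f" for g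
  proof -
    obtain s where s: "s \<in> null" "g = s \<oplus>\<^bsub>F\<^esub> f"
      using F.mem_cosetE[OF submodule_tensor_null \<open>g \<in> cls f\<close>] .
    then have "leibniz_act I act x g = leibniz_act I act x s \<oplus>\<^bsub>F\<^esub> leibniz_act I act x f"
      using f null_in_free_space[OF s(1)] by (simp add: leibniz_act_add mem_free_space)
    then show ?thesis
      using F.coset_eqI[OF submodule_tensor_null leibniz_act_closed[where act = act, OF f lin]
          leibniz_act_null[where act = act, OF s(1) lin]]
      by simp
  qed
  moreover have "f \<in> cls f"
    by (rule abelian_subgroup.a_rcos_self[OF F.abelian_subgroup_of_submodule[OF submodule_tensor_null] f])
  ultimately show ?thesis
    unfolding tensor_act_def by blast
qed

lemma linear_map_tensor_act:
  "linear_map (tensor_space I V) (tensor_space I V) (tensor_act I V act x)"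
  unfolding linear_map_def
proof (intro conjI ballI allI funcsetI)
  note closed = leibniz_act_closed[where act = act, OF _ lin]
  fix X assume "X \<in> carrier (tensor_space I V)"
  then obtain f where f: "f \<in> carrier F" "X = cls f"
    by (auto simp: carrier_tensor_space)
  show "tensor_act I V act x X \<in> carrier (tensor_space I V)"
    by (simp only: f tensor_act_coset carrier_tensor_space) (intro imageI closed f)
  show "tensor_act I V act x (c \<odot>\<^bsub>tensor_space I V\<^esub> X)
      = c \<odot>\<^bsub>tensor_space I V\<^esub> tensor_act I V act x X" for c
  proof -
    have "leibniz_act I act x (c \<odot>\<^bsub>F\<^esub> f) = c \<odot>\<^bsub>F\<^esub> leibniz_act I act x f"
      using f by (simp add: leibniz_act_smult mem_free_space)
    then show ?thesis
      by (simp only: f tensor_act_coset smult_tensor_space closed F.complex_smult_closed)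
  qed
  fix Y assume "Y \<in> carrier (tensor_space I V)"
  then obtain g where g: "g \<in> carrier F" "Y = cls g"
    by (auto simp: carrier_tensor_space)
  have "leibniz_act I act x (f \<oplus>\<^bsub>F\<^esub> g) = leibniz_act I act x f \<oplus>\<^bsub>F\<^esub> leibniz_act I act x g"
    using f g by (simp add: leibniz_act_add mem_free_space)
  then show "tensor_act I V act x (X \<oplus>\<^bsub>tensor_space I V\<^esub> Y)
      = tensor_act I V act x X \<oplus>\<^bsub>tensor_space I V\<^esub> tensor_act I V act x Y"
    by (simp only: f g tensor_act_coset add_tensor_space closed F.M.a_closed)
qed

end

text \<open>Lie algebra elements enter only through the operators \<open>act i (y k)\<close>, so
  \<open>y\<close> may be any family indexed by integers. Modulo null elements, the k-th coefficient
  of the product sends a combination of tuples u to the same combination of the tuples with one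
  entry replaced by its image under the k-th coefficient for that factor. For small k each such
  tuple has a zero entry.\<close>

lemma poly_times_series_tensor_act:
  fixes act :: "'i \<Rightarrow> 'b \<Rightarrow> 'v \<Rightarrow> 'v" and y :: "int \<Rightarrow> 'b"
  assumes lin: "\<And>i k. i \<in> I \<Longrightarrow> linear_map (V i) (V i) (act i (y k))"
    and trunc: "\<And>i v. i \<in> I \<Longrightarrow> v \<in> carrier (V i) \<Longrightarrow>
      \<exists>K. \<forall>k<K. poly_times_series (V i) N p (\<lambda>k. act i (y k)) k v = \<zero>\<^bsub>V i\<^esub>"
  shows "poly_times_series (tensor_space I V) N p (\<lambda>k. tensor_act I V act (y k))
    \<in> Hom_lower_truncated (tensor_space I V)"
  unfolding Hom_lower_truncated_def mem_Collect_eq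
proof (intro conjI allI ballI)
  fix k
  show "linear_map (tensor_space I V) (tensor_space I V)
      (poly_times_series (tensor_space I V) N p (\<lambda>k. tensor_act I V act (y k)) k)"
    by (intro poly_times_series_linear complex_space_tensor_space linear_map_tensor_act lin)
next
  fix X assume "X \<in> carrier (tensor_space I V)"
  then obtain f where f: "f \<in> carrier F" "X = cls f"
    by (auto simp: carrier_tensor_space)
  let ?S = "{u. f u \<noteq> 0}"
  have S: "finite ?S" "?S \<subseteq> tuples I V"
    using f by (auto simp: mem_free_space)
  \<comment> \<open>The bound in \<open>trunc\<close> depends on the pair (u, i). There are finitely
    many pairs, so the filter \<open>at_bot\<close> yields one bound for all.\<close>
  have "eventually (\<lambda>k. \<forall>u\<in>?S. \<forall>i\<in>I.
      poly_times_series (V i) N p (\<lambda>k. act i (y k)) k (u i) = \<zero>\<^bsub>V i\<^esub>) at_bot"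
    by (intro eventually_ball_finite ballI S finite_index)
      (unfold eventually_at_bot_dense, use S in \<open>blast intro: trunc tuple_component\<close>)
  then obtain K where K: "\<And>k u i. k < K \<Longrightarrow> u \<in> ?S \<Longrightarrow> i \<in> I \<Longrightarrow>
      poly_times_series (V i) N p (\<lambda>k. act i (y k)) k (u i) = \<zero>\<^bsub>V i\<^esub>"
    unfolding eventually_at_bot_dense by blast
  have "poly_times_series (tensor_space I V) N p (\<lambda>k. tensor_act I V act (y k)) k X
      = \<zero>\<^bsub>tensor_space I V\<^esub>" if k: "k < K" for k
  proof -
    let ?y = "\<lambda>m. y (k - int (N * m))"
    let ?D = "\<lambda>m. leibniz_act I act (?y m) f"
    have D: "?D m \<in> carrier F" for m
      by (intro leibniz_act_closed f lin)
    have cD: "coeff p m \<odot>\<^bsub>F\<^esub> ?D m \<in> carrier F" for m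
      by (intro F.complex_smult_closed D)
    \<comment> \<open>The sum over m stands innermost, where it vanishes modulo null for each u and
      i; exchanging sums afterwards gives the combination of Leibniz images. The factor 1 gives the
      inner sum the form required by \<open>null_sum\<close>.\<close>
    have "(\<lambda>b. \<Sum>u\<in>?S. f u * (\<Sum>i\<in>I. 1 *
        (\<Sum>m\<le>degree p. coeff p m * free_gen (u(i := act i (?y m) (u i))) b))) \<in> null"
    proof (rule null_sum[OF S(1)], rule null_sum[OF finite_index])
      fix u i assume u: "u \<in> ?S" and i: "i \<in> I"
      then have "u \<in> tuples I V" using S by blast
      then show "(\<lambda>b. \<Sum>m\<le>degree p. coeff p m * free_gen (u(i := act i (?y m) (u i))) b) \<in> null"
        using K[OF k u i] i
        by (intro null_zero_slot_sum linear_mapD(1)[OF lin] tuple_component)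
          (auto simp: poly_times_series_def)
    qed
    also have "(\<lambda>b. \<Sum>u\<in>?S. f u * (\<Sum>i\<in>I. 1 *
          (\<Sum>m\<le>degree p. coeff p m * free_gen (u(i := act i (?y m) (u i))) b)))
        = (\<lambda>b. \<Sum>m\<le>degree p. coeff p m * ?D m b)"
    proof
      fix b
      have "(\<Sum>u\<in>?S. f u * (\<Sum>i\<in>I. 1 *
            (\<Sum>m\<le>degree p. coeff p m * free_gen (u(i := act i (?y m) (u i))) b)))
          = (\<Sum>u\<in>?S. \<Sum>m\<le>degree p. coeff p m * (f u *
              (\<Sum>i\<in>I. free_gen (u(i := act i (?y m) (u i))) b)))"
        unfolding mult_1 by (subst sum.swap) (simp add: sum_distrib_left mult.left_commute)
      also have "\<dots> = (\<Sum>m\<le>degree p. coeff p m * ?D m b)"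
        unfolding leibniz_act_def by (subst sum.swap) (simp add: sum_distrib_left)
      finally show "(\<Sum>u\<in>?S. f u * (\<Sum>i\<in>I. 1 *
            (\<Sum>m\<le>degree p. coeff p m * free_gen (u(i := act i (?y m) (u i))) b)))
          = (\<Sum>m\<le>degree p. coeff p m * ?D m b)" .
    qed
    also have "\<dots> = (\<Oplus>\<^bsub>F\<^esub>m\<in>{..degree p}. coeff p m \<odot>\<^bsub>F\<^esub> ?D m)"
      using cD by (subst finsum_free_space) auto
    finally have null: "(\<Oplus>\<^bsub>F\<^esub>m\<in>{..degree p}. coeff p m \<odot>\<^bsub>F\<^esub> ?D m) \<in> null" .
    have "tensor_act I V act (?y m) X = cls (?D m)" for m
      unfolding f(2) by (rule tensor_act_coset[where act = act, OF lin f(1)])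
    then have "poly_times_series (tensor_space I V) N p (\<lambda>k. tensor_act I V act (y k)) k X
        = (\<Oplus>\<^bsub>tensor_space I V\<^esub>m\<in>{..degree p}. cls (coeff p m \<odot>\<^bsub>F\<^esub> ?D m))"
      by (simp only: poly_times_series_def smult_tensor_space D)
    also have "\<dots> = cls (\<Oplus>\<^bsub>F\<^esub>m\<in>{..degree p}. coeff p m \<odot>\<^bsub>F\<^esub> ?D m)"
      by (rule finsum_tensor_space) (use cD in auto)
    also have "\<dots> = \<zero>\<^bsub>tensor_space I V\<^esub>"
      by (rule coset_eq_zero_tensor_space[OF null])
    finally show ?thesis .
  qed
  then show "\<exists>K. \<forall>k<K. poly_times_series (tensor_space I V) N p (\<lambda>k. tensor_act I V act (y k)) k X
      = \<zero>\<^bsub>tensor_space I V\<^esub>"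
    by blast
qed

end

section \<open>Eigenspace decomposition\<close>

text \<open>Orthogonality of the characters of the cyclic group of order N: the sum is geometric
  with ratio \<open>\<omega> ^ j / \<omega> ^ i\<close>, an N-th root of unity that equals 1 only
  for i = j.\<close>

lemma sum_root_unity_powers:
  fixes i j N :: nat
  defines "\<omega> \<equiv> exp (2 * of_real pi * \<i> / of_nat N) :: complex"
  assumes "i < N" "j < N"
  shows "(\<Sum>k<N. inverse \<omega> ^ (i * k) / of_nat N * \<omega> ^ (j * k)) = (if i = j then 1 else 0)"
proof -
  \<comment> \<open>The \<open>cis\<close> form matches \<open>bij_betw_roots_unity\<close>, whose
    injectivity separates the powers of \<omega> with exponents below N.\<close>
  have pow: "\<omega> ^ m = cis (2 * pi * real m / real N)" for m
    by (simp add: \<omega>_def cis_conv_exp flip: exp_of_nat_mult) (simp add: mult_ac)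
  have nz: "\<omega> \<noteq> 0"
    by (simp add: \<omega>_def)
  let ?q = "\<omega> ^ j / \<omega> ^ i"
  have "\<omega> ^ N = 1"
    using \<open>i < N\<close> by (simp add: pow)
  then have "?q ^ N = 1"
    by (metis div_by_1 power_commutes power_divide power_mult power_one mult.commute)
  moreover have "?q \<noteq> 1" if "i \<noteq> j"
  proof
    assume "?q = 1"
    then have "\<omega> ^ i = \<omega> ^ j"
      using nz by simp
    moreover have "inj_on (\<lambda>m. \<omega> ^ m) {..<N}"
      unfolding pow using bij_betw_roots_unity[of N] assms by (simp add: bij_betw_def)
    ultimately show False
      using that assms by (auto dest: inj_onD)
  qed
  moreover have "(\<Sum>k<N. inverse \<omega> ^ (i * k) / of_nat N * \<omega> ^ (j * k)) = (\<Sum>k<N. ?q ^ k) / of_nat N"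
    by (simp add: sum_divide_distrib power_divide power_inverse field_simps flip: power_mult)
  ultimately show ?thesis
    using assms nz by (auto simp: geometric_sum)
qed

text \<open>Adding \<open>h 0 = h N\<close> to either side gives the sum over all indices from 0 to
  N, and the common term cancels.\<close>

lemma (in complex_space) finsum_cyclic_shift:
  fixes h :: "nat \<Rightarrow> 'v"
  assumes "\<And>k. h k \<in> carrier V" "h N = h 0"
  shows "(\<Oplus>\<^bsub>V\<^esub>k\<in>{..<N}. h (Suc k)) = (\<Oplus>\<^bsub>V\<^esub>k\<in>{..<N}. h k)"
proof (cases N)
  case (Suc n)
  have "(\<Oplus>\<^bsub>V\<^esub>k\<in>{..n}. h (Suc k)) \<oplus>\<^bsub>V\<^esub> h 0 = (\<Oplus>\<^bsub>V\<^esub>k\<in>{..n}. h k) \<oplus>\<^bsub>V\<^esub> h 0"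
    using M.finsum_Suc2[of h n] M.finsum_Suc[of h n] assms Suc
    by (simp add: Pi_def M.a_comm M.finsum_closed)
  then show ?thesis
    using assms by (simp add: Suc lessThan_Suc_atMost Pi_def)
qed simp

lemma linear_map_funpow: "linear_map V V f \<Longrightarrow> linear_map V V (f ^^ k)"
  by (induction k) (auto simp: linear_map_def Pi_def)

text \<open>Since \<open>eigen_component\<close> is a definite description, its value is known to lie in the Lie algebra
  only once the eigenspace decomposition is shown to exist and to be unique; both follow from the
  averaging projections.\<close>

locale cyclic_action = complex_space V
  for V :: "(complex, 'v) module" (structure) +
  fixes \<sigma> :: "'v \<Rightarrow> 'v" and N :: nat
  assumes linear: "linear_map V V \<sigma>"
    and order: "0 < N" "\<And>x. x \<in> carrier V \<Longrightarrow> (\<sigma> ^^ N) x = x"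
begin

definition \<omega> :: complex where
  "\<omega> = exp (2 * of_real pi * \<i> / of_nat N)"

text \<open>Discrete Fourier weights: the weighted sum of the powers of \<sigma> picks out the
  eigenvalue \<open>\<omega> ^ i\<close>.\<close>

definition proj_coeff :: "nat \<Rightarrow> nat \<Rightarrow> complex" where
  "proj_coeff i k = inverse \<omega> ^ (i * k) / of_nat N"

definition eigen_proj :: "nat \<Rightarrow> 'v \<Rightarrow> 'v" where
  "eigen_proj i x = (\<Oplus>\<^bsub>V\<^esub>k\<in>{..<N}. proj_coeff i k \<odot> (\<sigma> ^^ k) x)"

lemma mem_eigenspace: "x \<in> eigenspace V \<sigma> N i \<longleftrightarrow> x \<in> carrier V \<and> \<sigma> x = \<omega> ^ i \<odot> x"
  by (simp add: eigenspace_def \<omega>_def)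

lemma omega_nonzero [simp]: "\<omega> \<noteq> 0"
  by (simp add: \<omega>_def)

lemma omega_pow_N: "\<omega> ^ N = 1"
  using order(1) by (simp add: \<omega>_def flip: exp_of_nat_mult)

lemma pow_closed [simp]: "x \<in> carrier V \<Longrightarrow> (\<sigma> ^^ k) x \<in> carrier V"
  using linear_mapD(1)[OF linear_map_funpow[OF linear]] .

lemma linear_eigen_proj: "linear_map V V (eigen_proj i)"
  unfolding eigen_proj_def[abs_def]
  by (intro linear_map_finsum_smult linear_map_funpow linear) simp

text \<open>Applying \<sigma> moves each summand to the next index at the cost of a factor
  \<open>\<omega> ^ i\<close>. The shift closes up cyclically because the N-th powers of \<sigma>
  and \<omega> are trivial.\<close>

lemma eigen_proj_in_eigenspace:
  assumes x: "x \<in> carrier V"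
  shows "eigen_proj i x \<in> eigenspace V \<sigma> N i"
proof -
  let ?h = "\<lambda>k. (\<omega> ^ i * proj_coeff i k) \<odot> (\<sigma> ^^ k) x"
  have coeff: "proj_coeff i k = \<omega> ^ i * proj_coeff i (Suc k)" for k
    by (simp add: proj_coeff_def power_add power_inverse)
  have "inverse \<omega> ^ (i * N) = 1"
    by (simp add: power_inverse mult.commute[of i] power_mult omega_pow_N)
  then have "?h N = ?h 0"
    using x order(2)[OF x] by (simp add: proj_coeff_def)
  then have "(\<Oplus>\<^bsub>V\<^esub>k\<in>{..<N}. ?h (Suc k)) = (\<Oplus>\<^bsub>V\<^esub>k\<in>{..<N}. ?h k)"
    using x by (intro finsum_cyclic_shift) simp_all
  moreover have "\<sigma> (eigen_proj i x) = (\<Oplus>\<^bsub>V\<^esub>k\<in>{..<N}. \<sigma> (proj_coeff i k \<odot> (\<sigma> ^^ k) x))"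
    unfolding eigen_proj_def
    using x by (intro linear_map_finsum[OF complex_space_axioms complex_space_axioms linear]) auto
  moreover have "\<sigma> (proj_coeff i k \<odot> (\<sigma> ^^ k) x) = ?h (Suc k)" for k
    using x by (simp add: linear_mapD(3)[OF linear] coeff[of k])
  moreover have "\<omega> ^ i \<odot> eigen_proj i x = (\<Oplus>\<^bsub>V\<^esub>k\<in>{..<N}. \<omega> ^ i \<odot> (proj_coeff i k \<odot> (\<sigma> ^^ k) x))"
    unfolding eigen_proj_def using x by (intro finsum_smult_right[symmetric]) auto
  ultimately show ?thesis
    using x linear_mapD(1)[OF linear_eigen_proj x] by (simp add: mem_eigenspace smult_smult)
qed

lemma eigen_proj_eigenvector:
  assumes x: "x \<in> eigenspace V \<sigma> N j" and "i < N" "j < N"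
  shows "eigen_proj i x = (if i = j then x else \<zero>\<^bsub>V\<^esub>)"
proof -
  have x': "x \<in> carrier V"
    using x by (simp add: mem_eigenspace)
  have "(\<sigma> ^^ k) x = \<omega> ^ (j * k) \<odot> x" for k
    using x by (induction k)
      (simp_all add: mem_eigenspace linear_mapD(3)[OF linear] smult_smult power_add mult.commute)
  then have "eigen_proj i x = (\<Oplus>\<^bsub>V\<^esub>k\<in>{..<N}. (proj_coeff i k * \<omega> ^ (j * k)) \<odot> x)"
    using x' by (simp add: eigen_proj_def smult_smult)
  also have "\<dots> = (\<Sum>k<N. proj_coeff i k * \<omega> ^ (j * k)) \<odot> x"
    using x' by (intro finsum_smult_left) simp_all
  also have "(\<Sum>k<N. proj_coeff i k * \<omega> ^ (j * k)) = (if i = j then 1 else 0)"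
    unfolding proj_coeff_def \<omega>_def using assms(2,3) by (rule sum_root_unity_powers)
  finally show ?thesis
    using x' by simp
qed

text \<open>After exchanging the sums, the weights of \<open>(\<sigma> ^^ k) x\<close> add up over i
  to zero unless k = 0, which leaves x.\<close>

lemma sum_eigen_proj:
  assumes x: "x \<in> carrier V"
  shows "(\<Oplus>\<^bsub>V\<^esub>i\<in>{..<N}. eigen_proj i x) = x"
proof -
  have delta: "(\<Sum>i<N. proj_coeff i k) = (if k = 0 then 1 else 0)" if "k < N" for k
  proof -
    \<comment> \<open>The same orthogonality with i and k exchanged, the second character being the
      trivial one.\<close>
    have "(\<Sum>i<N. proj_coeff i k) = (\<Sum>i<N. inverse \<omega> ^ (k * i) / of_nat N * \<omega> ^ (0 * i))"
      by (simp add: proj_coeff_def mult.commute)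
    also have "\<dots> = (if k = 0 then 1 else 0)"
      unfolding \<omega>_def using that order(1) by (rule sum_root_unity_powers)
    finally show ?thesis .
  qed
  have "(\<Oplus>\<^bsub>V\<^esub>i\<in>{..<N}. eigen_proj i x) = (\<Oplus>\<^bsub>V\<^esub>k\<in>{..<N}. \<Oplus>\<^bsub>V\<^esub>i\<in>{..<N}. proj_coeff i k \<odot> (\<sigma> ^^ k) x)"
    unfolding eigen_proj_def using x by (intro finsum_commute) simp_all
  also have "\<dots> = (\<Oplus>\<^bsub>V\<^esub>k\<in>{..<N}. (\<Sum>i<N. proj_coeff i k) \<odot> (\<sigma> ^^ k) x)"
    using x by (intro M.finsum_cong' finsum_smult_left) auto
  also have "\<dots> = (\<Oplus>\<^bsub>V\<^esub>k\<in>{..<N}. if 0 = k then (\<sigma> ^^ k) x else \<zero>\<^bsub>V\<^esub>)"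
    using x by (intro M.finsum_cong') (auto simp: delta)
  also have "\<dots> = (\<sigma> ^^ 0) x"
    using x order(1) by (intro M.finsum_singleton) auto
  finally show ?thesis by simp
qed

text \<open>The projections of x give one decomposition. Applying \<open>eigen_proj i\<close> to any
  other decomposition kills all its terms except the i-th, so the two agree.\<close>

lemma eigen_component_in_eigenspace:
  assumes x: "x \<in> carrier V" and "i < N"
  shows "eigen_component V \<sigma> N x i \<in> eigenspace V \<sigma> N i"
proof -
  \<comment> \<open>Uniqueness as a function needs the fixed value \<open>undefined\<close> outside
    the index range, which \<open>restrict\<close> provides.\<close>
  have "eigen_component V \<sigma> N x = restrict (\<lambda>i. eigen_proj i x) {..<N}"
    unfolding eigen_component_def
  proof (rule the_equality)
    have "(\<Oplus>\<^bsub>V\<^esub>i\<in>{..<N}. restrict (\<lambda>i. eigen_proj i x) {..<N} i) = (\<Oplus>\<^bsub>V\<^esub>i\<in>{..<N}. eigen_proj i x)"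
      using linear_mapD(1)[OF linear_eigen_proj x] by (intro M.finsum_cong') auto
    then show "restrict (\<lambda>i. eigen_proj i x) {..<N} \<in> (\<Pi>\<^sub>E i\<in>{..<N}. eigenspace V \<sigma> N i) \<and>
        x = (\<Oplus>\<^bsub>V\<^esub>i\<in>{..<N}. restrict (\<lambda>i. eigen_proj i x) {..<N} i)"
      using x by (auto simp: sum_eigen_proj eigen_proj_in_eigenspace)
  next
    fix b assume b: "b \<in> (\<Pi>\<^sub>E i\<in>{..<N}. eigenspace V \<sigma> N i) \<and> x = (\<Oplus>\<^bsub>V\<^esub>i\<in>{..<N}. b i)"
    have b_eig: "b j \<in> eigenspace V \<sigma> N j" if "j < N" for j
      using b that by (auto simp: PiE_def Pi_def)
    then have b_carr: "b j \<in> carrier V" if "j < N" for j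
      using that by (simp add: mem_eigenspace)
    have "eigen_proj i x = b i" if "i < N" for i
    proof -
      have "eigen_proj i x = (\<Oplus>\<^bsub>V\<^esub>j\<in>{..<N}. eigen_proj i (b j))"
        using b_carr conjunct2[OF b]
        by (simp add: linear_map_finsum[OF complex_space_axioms complex_space_axioms linear_eigen_proj] Pi_def)
      also have "\<dots> = (\<Oplus>\<^bsub>V\<^esub>j\<in>{..<N}. if i = j then b j else \<zero>\<^bsub>V\<^esub>)"
        using b_carr that by (intro M.finsum_cong') (auto simp: eigen_proj_eigenvector b_eig)
      also have "\<dots> = b i"
        using b_carr that by (intro M.finsum_singleton) auto
      finally show ?thesis .
    qed
    then show "b = restrict (\<lambda>i. eigen_proj i x) {..<N}"
      using b by (auto simp: fun_eq_iff PiE_def extensional_def)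
  qed
  then show ?thesis
    using assms by (simp add: eigen_proj_in_eigenspace)
qed

end

section \<open>Evaluation modules\<close>

locale evaluation_space = G: complex_space G + lie_module G br U act
  for G :: "(complex, 'a) module" and br :: "'a \<Rightarrow> 'a \<Rightarrow> 'a"
    and U :: "(complex, 'v) module" and act :: "'a \<Rightarrow> 'v \<Rightarrow> 'v"
begin

sublocale U: complex_space U
  by (simp add: complex_space_def module_axioms)

lemma eval_act_loop_elem:
  assumes "a \<in> carrier G" "u \<in> carrier U"
  shows "eval_act G N z \<zeta> U act (loop_elem G a k) u
    = (z powi (k div int N) * \<zeta> ^ nat (k mod int N)) \<odot>\<^bsub>U\<^esub> act a u"
\<comment> \<open>The sum in \<open>eval_act\<close> runs over the support of the loop element,
  which is empty for a = 0 and \<open>{k}\<close> otherwise.\<close>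
proof (cases "a = \<zero>\<^bsub>G\<^esub>")
  case True
  have "act \<zero>\<^bsub>G\<^esub> u = \<zero>\<^bsub>U\<^esub>"
    using act_smult[of "\<zero>\<^bsub>G\<^esub>" u 0] assms linear_mapD(1)[OF act_linear, of "\<zero>\<^bsub>G\<^esub>" u] by simp
  then show ?thesis
    by (simp add: True eval_act_def loop_elem_def)
next
  case False
  then have "{p. (if p = k then a else \<zero>\<^bsub>G\<^esub>) \<noteq> \<zero>\<^bsub>G\<^esub>} = {k}"
    by auto
  then show ?thesis
    using linear_mapD(1)[OF act_linear[OF assms(1)] assms(2)]
    by (simp add: eval_act_def loop_elem_def M.finsum_insert)
qed

lemma linear_map_eval_act_loop_elem:
  assumes a: "a \<in> carrier G"
  shows "linear_map U U (eval_act G N z \<zeta> U act (loop_elem G a k))"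
  using linear_mapD[OF act_linear[OF a]] a
  by (simp add: linear_map_def eval_act_loop_elem smult_r_distr U.smult_smult mult.commute)

text \<open>Stepping down by N m in the exponent of \<open>x^(1/N)\<close> raises the loop index by
  N m. Its residue modulo N is unchanged, so the eigencomponent and the power of \<zeta> stay the
  same, while its quotient by N grows by m and produces the factor \<open>z ^ m\<close>.\<close>

lemma poly_times_eval_series:
  assumes "0 < N" "z \<noteq> 0" "poly p z = 0" "u \<in> carrier U"
    and a: "\<And>i. i < N \<Longrightarrow> eigen_component G \<sigma> N a i \<in> carrier G"
  shows "poly_times_series U N p (gen_series G \<sigma> N (eval_act G N z \<zeta> U act) a) k u = \<zero>\<^bsub>U\<^esub>"
proof (rule poly_times_series_eq_zero[OF U.complex_space_axioms])
  let ?A = "gen_series G \<sigma> N (eval_act G N z \<zeta> U act) a"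
  define a' where "a' k = eigen_component G \<sigma> N a (nat ((- k - int N) mod int N))" for k
  have a': "a' k \<in> carrier G" for k
    unfolding a'_def using assms(1) by (intro a) (simp add: nat_less_iff)
  have A: "?A k u = (z powi ((- k - int N) div int N) * \<zeta> ^ nat ((- k - int N) mod int N))
      \<odot>\<^bsub>U\<^esub> act (a' k) u" for k
    unfolding gen_series_def Let_def a'_def
    by (rule eval_act_loop_elem[OF a'[unfolded a'_def] assms(4)])
  show "?A k u \<in> carrier U"
    unfolding A using linear_mapD(1)[OF act_linear[OF a'] assms(4)] by simp
  fix m
  have shift: "- (k - int (N * m)) - int N = (- k - int N) + int m * int N"
    by (simp add: algebra_simps)
  have "a' (k - int (N * m)) = a' k"
    unfolding a'_def shift by simp
  then show "?A (k - int (N * m)) u = z ^ m \<odot>\<^bsub>U\<^esub> ?A k u"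
    unfolding A shift using linear_mapD(1)[OF act_linear[OF a'] assms(4), of k] assms(1,2)
    by (simp add: U.smult_smult power_int_add mult_ac)
qed fact

end

theorem lemma4p2:
  fixes G :: "(complex, 'a) module"
    and br :: "'a \<Rightarrow> 'a \<Rightarrow> 'a"
    and form :: "'a \<Rightarrow> 'a \<Rightarrow> complex"
    and \<sigma> :: "'a \<Rightarrow> 'a"
    and N r :: nat
    and nth_root :: "complex \<Rightarrow> complex"
    and U :: "nat \<Rightarrow> (complex, 'v) module"
    and act_U :: "nat \<Rightarrow> 'a \<Rightarrow> 'v \<Rightarrow> 'v"
    and z :: "nat \<Rightarrow> complex"
    and W :: "(complex, 'v) module"
    and act_W :: "'a affine \<Rightarrow> 'v \<Rightarrow> 'v"
  assumes "simple_lie_algebra G br"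
    and "finite_dimensional G"
    and "normalized_invariant_form G br form"
    and "lie_automorphism G br \<sigma>"
    and "map_order G \<sigma> N"
    and "\<And>y. y \<noteq> 0 \<Longrightarrow> nth_root y ^ N = y"
    and "\<And>j. j \<in> {1..r} \<Longrightarrow> lie_module G br (U j) (act_U j)"
    and "\<And>j. j \<in> {1..r} \<Longrightarrow> z j \<noteq> 0"
    and "restricted_module G br form \<sigma> N W act_W"
  shows "let V = (\<lambda>j. if j = 0 then W else U j);
             act_V = (\<lambda>j. if j = 0 then act_W
                          else eval_act G N (z j) (nth_root (z j)) (U j) (act_U j));
             M = tensor_space {0..r} V;
             act_M = tensor_act {0..r} V act_V
         in \<forall>a\<in>carrier G.
              poly_times_series M N (\<Prod>j\<in>{1..r}. [:- z j, 1:]) (gen_series G \<sigma> N act_M a)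
                \<in> Hom_lower_truncated M"
proof -
  define V where "V = (\<lambda>j. if j = 0 then W else U j)"
  define act_V where "act_V = (\<lambda>j. if j = 0 then act_W
    else eval_act G N (z j) (nth_root (z j)) (U j) (act_U j))"
  interpret G: simple_lie_algebra G br
    by fact
  interpret G: cyclic_action G \<sigma> N
    using assms(4,5) by unfold_locales (auto simp: lie_automorphism_def map_order_def)
  have W: "complex_space W"
    "\<And>a. a \<in> carrier G \<Longrightarrow> gen_series G \<sigma> N act_W a \<in> Hom_lower_truncated W"
    using assms(9) by (simp_all add: restricted_module_def lie_module_def complex_space_def)
  have U: "evaluation_space G br (U j) (act_U j)" if "j \<in> {1..r}" for j
    using assms(7)[OF that] by (intro evaluation_space.intro G.complex_space_axioms)
  interpret tensor_family "{0..r}" V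
  proof (rule tensor_family.intro)
    show "complex_space (V j)" if "j \<in> {0..r}" for j
      using that W(1) evaluation_space.axioms(2)[OF U, of j]
      by (auto simp: V_def lie_module_def complex_space_def)
  qed simp
  have "poly_times_series (tensor_space {0..r} V) N (\<Prod>j\<in>{1..r}. [:- z j, 1:])
      (gen_series G \<sigma> N (tensor_act {0..r} V act_V) a) \<in> Hom_lower_truncated (tensor_space {0..r} V)"
    if a: "a \<in> carrier G" for a
  proof -
    \<comment> \<open>One family of loop elements serves W, the evaluation modules and the tensor
      product; only the action applied to it varies.\<close>
    define y where "y k = (let p = - k - int N in
      loop_elem G (eigen_component G \<sigma> N a (nat (p mod int N))) p)" for k
    have series: "gen_series G \<sigma> N f a = (\<lambda>k. f (y k))" for f :: "'a affine \<Rightarrow> 'w \<Rightarrow> 'w"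
      by (simp add: gen_series_def y_def Let_def)
    have comp: "eigen_component G \<sigma> N a i \<in> carrier G" if "i < N" for i
      using G.eigen_component_in_eigenspace[OF a that] by (simp add: G.mem_eigenspace)
    have lin: "linear_map (V j) (V j) (act_V j (y k))" if j: "j \<in> {0..r}" for j k
    proof (cases "j = 0")
      case True
      then show ?thesis
        using W(2)[OF a] by (simp add: V_def act_V_def series Hom_lower_truncated_def)
    next
      case False
      with j have "evaluation_space G br (U j) (act_U j)"
        by (intro U) simp
      moreover have "eigen_component G \<sigma> N a (nat ((- k - int N) mod int N)) \<in> carrier G"
        using G.order(1) by (intro comp) (simp add: nat_less_iff)
      ultimately show ?thesis
        using False
        by (simp add: V_def act_V_def y_def Let_def evaluation_space.linear_map_eval_act_loop_elem)
    qed
    have trunc: "\<exists>K. \<forall>k<K. poly_times_series (V j) N (\<Prod>j\<in>{1..r}. [:- z j, 1:])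
        (\<lambda>k. act_V j (y k)) k v = \<zero>\<^bsub>V j\<^esub>"
      if j: "j \<in> {0..r}" and v: "v \<in> carrier (V j)" for j v
    proof (cases "j = 0")
      case True
      then show ?thesis
        using poly_times_series_lower_truncated[OF W(1) W(2)[OF a]] v
        by (simp add: V_def act_V_def series)
    next
      case False
      with j have j': "j \<in> {1..r}"
        by simp
      then have "poly (\<Prod>j\<in>{1..r}. [:- z j, 1:]) (z j) = 0"
        by (auto simp: poly_prod)
      \<comment> \<open>On an evaluation factor the coefficient vanishes at every index, so any
        bound K will do.\<close>
      from evaluation_space.poly_times_eval_series[OF U[OF j'] G.order(1) assms(8)[OF j'] this _ comp]
      show ?thesis
        using False v by (auto simp: V_def act_V_def series)
    qed
    show ?thesis
      unfolding series by (rule poly_times_series_tensor_act[where act = act_V and y = y, OF lin trunc])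
  qed
  then show ?thesis
    unfolding V_def act_V_def by (simp add: Let_def)
qed

end
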